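(* Let $I\subseteq K[x_1,\ldots,x_n]$ be an ideal and $\succ$ an admissible monomial ordering compatible with $x_1\succ x_2\succ\cdots\succ x_n$. The following are equivalent: (i) $I$ has a finite Pommaret basis; (ii) a minimal Janet basis of $I$ is a Pommaret basis of $I$; (iii) if $F$ is any Janet basis of $I$, then $G=Autoreduce_{PJ}(F)$ is a Pommaret basis of $I$.
   Context: $K$ is a field of characteristic zero, $\mathbb{M}$ the set of monomials, $deg_i(u)$ the degree of $x_i$ in $u$, $lm(f)$ the leading monomial w.r.t. $\succ$, $lm(F)=\{lm(f):f\in F\}$, $Id(F)$ the ideal generated by $F$. Pommaret division: for $u=x_1^{d_1}\cdots x_k^{d_k}$ with $d_k>0$, the variables $x_j$, $j\ge k$, are P-multiplicative for $u$ and the others P-nonmultiplicative; for $u=1$ all are P-multiplicative. $P(u)$: monomials in P-multiplicative variables of $u$. For a polynomial $f$ use $u=lm(f)$; $NM_P(f)$ denotes its P-nonmultiplicative variables. Janet division: for finite $U\subset\mathbb{M}$ and $u\in U$, $x_1$ is J-multiplicative for $u$ iff $deg_1(u)=\max\{deg_1(v):v\in U\}$; for $i>1$, $x_i$ is J-multiplicative iff $deg_i(u)=\max\{deg_i(v):v\in U,\ deg_j(v)=deg_j(u)\ \forall j<i\}$; otherwise J-nonmultiplicative. $J(u,U)$: monomials in J-multiplicative variables of $u$. For $f$ in a finite set $F$ use $u=lm(f)$, $U=lm(F)$; $NM_J(f,F)$ denotes J-nonmultiplicative variables. $u$ is a P-divisor (J-divisor) of $w$ if $u\mid w$ and $w/u\in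 P(u)$ ($w/u\in J(u,U)$). $C_P(U)=\bigcup_{u\in U}uP(u)$. A (possibly infinite) polynomial set $F$ is P-autoreduced if no term of any $f\in F$ is a P-multiple of an element of $lm(F)\setminus\{lm(f)\}$; a finite $F$ is J-autoreduced if no term of any $f\in F$ has a J-divisor (w.r.t. $lm(F)$) in $lm(F)\setminus\{lm(f)\}$. $NF_P(f,F)$ (resp. $NF_J(f,F)$) is obtained from $f$ by repeatedly cancelling a term $c\,t$ with a P-divisor (resp. J-divisor) $lm(g)$, $g\in F$, by subtracting $\frac{c}{lc(g)}\frac{t}{lm(g)}g$, until no term has such a divisor. A P-autoreduced set $F$ is a Pommaret basis of $Id(F)$ if $NF_P(xf,F)=0$ for all $f\in F$, $x\in NM_P(f)$. A finite J-autoreduced $F$ is a Janet basis of $Id(F)$ if $NF_J(xf,F)=0$ for all $f\in F$, $x\in NM_J(f,F)$. A Janet basis $G$ of $I$ is minimal if $lm(G)\subseteq lm(F)$ for every Janet basis $F$ of $I$. $Autoreduce_J(H)$ denotes J-autoreduction (repeatedly replacing an element by its J-normal form modulo the others, discarding zeros, until J-autoreduced). Algorithm $Autoreduce_{PJ}(F)$: set $G:=\emptyset$, $H:=F$. Repeat: $\tilde H:=H$; while there exists $h\in H$ with $lm(h)\in C_P(lm(H\setminus\{h\}))$, set $H:=H\setminus\{h\}$, $G:=G\cup\{h\}$; then for each $g\in G$: remove $g$ from $G$, compute $f:=NF_J(g,H)$, and if $f\ne0$ set $H:=H\cup\{f\}$; until $H=\tilde H$. Return $Autoreduce_J(H)$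.
   Formalization: P- and J-autoreduced sets are also required to have pairwise distinct leading monomials (no term of f has an involutive divisor lm(g) with g ≠ f); without this, {x, x+1} would be a Janet basis of (1) beside {1}, and no minimal Janet basis would exist. *)

theory Defs
  imports "HOL-Library.Poly_Mapping"
begin

text \<open>Monomials in the variables x_1,...,x_n are exponent vectors (finitely supported
  maps nat to nat, support in 1..n); polynomials are finitely supported maps from
  monomials to coefficients (the library ring structure of poly_mapping, i.e. convolution).\<close>

type_synonym mono = "nat \<Rightarrow>\<^sub>0 nat"
type_synonym 'a mpoly = "mono \<Rightarrow>\<^sub>0 'a"

definition mons :: "nat \<Rightarrow> mono set" where
  "mons n = {u. Poly_Mapping.keys u \<subseteq> {1..n}}"

definition polys :: "nat \<Rightarrow> ('a::zero) mpoly set" where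
  "polys n = {p. Poly_Mapping.keys p \<subseteq> mons n}"

definition var :: "nat \<Rightarrow> mono" where
  "var i = Poly_Mapping.single i 1"

abbreviation deg :: "nat \<Rightarrow> mono \<Rightarrow> nat" where
  "deg i u \<equiv> Poly_Mapping.lookup u i"

definition admissible_order :: "nat \<Rightarrow> (mono \<Rightarrow> mono \<Rightarrow> bool) \<Rightarrow> bool" where
  "admissible_order n lt \<longleftrightarrow>
     (\<forall>u\<in>mons n. \<not> lt u u) \<and>
     (\<forall>u\<in>mons n. \<forall>v\<in>mons n. \<forall>w\<in>mons n. lt u v \<longrightarrow> lt v w \<longrightarrow> lt u w) \<and>
     (\<forall>u\<in>mons n. \<forall>v\<in>mons n. u \<noteq> v \<longrightarrow> lt u v \<or> lt v u) \<and>
     (\<forall>u\<in>mons n. u \<noteq> 0 \<longrightarrow> lt 0 u) \<and>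
     (\<forall>u\<in>mons n. \<forall>v\<in>mons n. \<forall>w\<in>mons n. lt u v \<longrightarrow> lt (u + w) (v + w))"

definition vars_ordered :: "nat \<Rightarrow> (mono \<Rightarrow> mono \<Rightarrow> bool) \<Rightarrow> bool" where
  "vars_ordered n lt \<longleftrightarrow> (\<forall>i. 1 \<le> i \<and> i < n \<longrightarrow> lt (var (Suc i)) (var i))"

definition lm :: "(mono \<Rightarrow> mono \<Rightarrow> bool) \<Rightarrow> ('a::zero) mpoly \<Rightarrow> mono" where
  "lm lt p = (THE u. u \<in> Poly_Mapping.keys p \<and> (\<forall>v\<in>Poly_Mapping.keys p. v \<noteq> u \<longrightarrow> lt v u))"

definition lc :: "(mono \<Rightarrow> mono \<Rightarrow> bool) \<Rightarrow> ('a::zero) mpoly \<Rightarrow> 'a" where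
  "lc lt p = Poly_Mapping.lookup p (lm lt p)"

definition is_ideal :: "nat \<Rightarrow> ('a::comm_ring_1) mpoly set \<Rightarrow> bool" where
  "is_ideal n I \<longleftrightarrow> I \<subseteq> polys n \<and> 0 \<in> I \<and> (\<forall>p\<in>I. \<forall>q\<in>I. p + q \<in> I) \<and>
     (\<forall>p\<in>I. \<forall>q\<in>polys n. q * p \<in> I)"

definition gen_ideal :: "nat \<Rightarrow> ('a::comm_ring_1) mpoly set \<Rightarrow> 'a mpoly set" where
  "gen_ideal n F = {p. \<exists>S q. finite S \<and> S \<subseteq> F \<and> (\<forall>f\<in>S. q f \<in> polys n) \<and>
                            p = (\<Sum>f\<in>S. q f * f)}"

text \<open>class of u: the largest k with deg_k(u) > 0; for u = 1 all variables are multiplicative.\<close>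
definition cls :: "mono \<Rightarrow> nat" where
  "cls u = (if u = 0 then 1 else Max (Poly_Mapping.keys u))"

definition P_mult :: "nat \<Rightarrow> mono \<Rightarrow> nat set" where
  "P_mult n u = {cls u..n}"

definition NM_P :: "nat \<Rightarrow> mono \<Rightarrow> nat set" where
  "NM_P n u = {1..n} - P_mult n u"

definition P_divides :: "nat \<Rightarrow> mono \<Rightarrow> mono \<Rightarrow> bool" where
  "P_divides n u w \<longleftrightarrow> (\<exists>v. Poly_Mapping.keys v \<subseteq> P_mult n u \<and> w = u + v)"

definition C_P :: "nat \<Rightarrow> mono set \<Rightarrow> mono set" where
  "C_P n U = {w. \<exists>u\<in>U. P_divides n u w}"

definition J_mult :: "nat \<Rightarrow> mono set \<Rightarrow> mono \<Rightarrow> nat set" where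
  "J_mult n U u = {i \<in> {1..n}.
     deg i u = Max {deg i v | v. v \<in> U \<and> (\<forall>j\<in>{1..<i}. deg j v = deg j u)}}"

definition NM_J :: "nat \<Rightarrow> mono set \<Rightarrow> mono \<Rightarrow> nat set" where
  "NM_J n U u = {1..n} - J_mult n U u"

definition J_divides :: "nat \<Rightarrow> mono set \<Rightarrow> mono \<Rightarrow> mono \<Rightarrow> bool" where
  "J_divides n U u w \<longleftrightarrow> (\<exists>v. Poly_Mapping.keys v \<subseteq> J_mult n U u \<and> w = u + v)"

definition P_autoreduced :: "nat \<Rightarrow> (mono \<Rightarrow> mono \<Rightarrow> bool) \<Rightarrow> ('a::zero) mpoly set \<Rightarrow> bool" where
  "P_autoreduced n lt F \<longleftrightarrow>
     (\<forall>f\<in>F. \<forall>g\<in>F. g \<noteq> f \<longrightarrow> (\<forall>t\<in>Poly_Mapping.keys f. \<not> P_divides n (lm lt g) t))"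

definition J_autoreduced :: "nat \<Rightarrow> (mono \<Rightarrow> mono \<Rightarrow> bool) \<Rightarrow> ('a::zero) mpoly set \<Rightarrow> bool" where
  "J_autoreduced n lt F \<longleftrightarrow> finite F \<and>
     (\<forall>f\<in>F. \<forall>g\<in>F. g \<noteq> f \<longrightarrow> (\<forall>t\<in>Poly_Mapping.keys f. \<not> J_divides n (lm lt ` F) (lm lt g) t))"

subsection \<open>Involutive normal forms (as the set of possible results of the reduction process)\<close>

definition P_red :: "nat \<Rightarrow> (mono \<Rightarrow> mono \<Rightarrow> bool) \<Rightarrow> ('a::field) mpoly set \<Rightarrow> 'a mpoly \<Rightarrow> 'a mpoly \<Rightarrow> bool" where
  "P_red n lt F p p' \<longleftrightarrow> (\<exists>t\<in>Poly_Mapping.keys p. \<exists>g\<in>F. \<exists>v. t = lm lt g + v \<and> P_divides n (lm lt g) t \<and>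
       p' = p - Poly_Mapping.single v (Poly_Mapping.lookup p t / lc lt g) * g)"

definition J_red :: "nat \<Rightarrow> (mono \<Rightarrow> mono \<Rightarrow> bool) \<Rightarrow> ('a::field) mpoly set \<Rightarrow> 'a mpoly \<Rightarrow> 'a mpoly \<Rightarrow> bool" where
  "J_red n lt F p p' \<longleftrightarrow> (\<exists>t\<in>Poly_Mapping.keys p. \<exists>g\<in>F. \<exists>v. t = lm lt g + v \<and> J_divides n (lm lt ` F) (lm lt g) t \<and>
       p' = p - Poly_Mapping.single v (Poly_Mapping.lookup p t / lc lt g) * g)"

definition NF_P :: "nat \<Rightarrow> (mono \<Rightarrow> mono \<Rightarrow> bool) \<Rightarrow> ('a::field) mpoly set \<Rightarrow> 'a mpoly \<Rightarrow> 'a mpoly \<Rightarrow> bool" where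
  "NF_P n lt F p r \<longleftrightarrow> (P_red n lt F)\<^sup>*\<^sup>* p r \<and>
     (\<forall>t\<in>Poly_Mapping.keys r. \<forall>g\<in>F. \<not> P_divides n (lm lt g) t)"

definition NF_J :: "nat \<Rightarrow> (mono \<Rightarrow> mono \<Rightarrow> bool) \<Rightarrow> ('a::field) mpoly set \<Rightarrow> 'a mpoly \<Rightarrow> 'a mpoly \<Rightarrow> bool" where
  "NF_J n lt F p r \<longleftrightarrow> (J_red n lt F)\<^sup>*\<^sup>* p r \<and>
     (\<forall>t\<in>Poly_Mapping.keys r. \<forall>g\<in>F. \<not> J_divides n (lm lt ` F) (lm lt g) t)"

definition pommaret_basis :: "nat \<Rightarrow> (mono \<Rightarrow> mono \<Rightarrow> bool) \<Rightarrow> ('a::field) mpoly set \<Rightarrow> 'a mpoly set \<Rightarrow> bool" where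
  "pommaret_basis n lt I F \<longleftrightarrow> F \<subseteq> polys n \<and> 0 \<notin> F \<and> P_autoreduced n lt F \<and> gen_ideal n F = I \<and>
     (\<forall>f\<in>F. \<forall>i\<in>NM_P n (lm lt f). \<forall>r. NF_P n lt F (Poly_Mapping.single (var i) 1 * f) r \<longrightarrow> r = 0)"

definition janet_basis :: "nat \<Rightarrow> (mono \<Rightarrow> mono \<Rightarrow> bool) \<Rightarrow> ('a::field) mpoly set \<Rightarrow> 'a mpoly set \<Rightarrow> bool" where
  "janet_basis n lt I F \<longleftrightarrow> finite F \<and> F \<subseteq> polys n \<and> 0 \<notin> F \<and> J_autoreduced n lt F \<and> gen_ideal n F = I \<and>
     (\<forall>f\<in>F. \<forall>i\<in>NM_J n (lm lt ` F) (lm lt f). \<forall>r. NF_J n lt F (Poly_Mapping.single (var i) 1 * f) r \<longrightarrow> r = 0)"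

definition minimal_janet_basis :: "nat \<Rightarrow> (mono \<Rightarrow> mono \<Rightarrow> bool) \<Rightarrow> ('a::field) mpoly set \<Rightarrow> 'a mpoly set \<Rightarrow> bool" where
  "minimal_janet_basis n lt I G \<longleftrightarrow> janet_basis n lt I G \<and>
     (\<forall>F. janet_basis n lt I F \<longrightarrow> lm lt ` G \<subseteq> lm lt ` F)"

subsection \<open>Autoreduce_J and Autoreduce_PJ (as relations: input, possible output)\<close>

definition J_ar_step :: "nat \<Rightarrow> (mono \<Rightarrow> mono \<Rightarrow> bool) \<Rightarrow> ('a::field) mpoly set \<Rightarrow> 'a mpoly set \<Rightarrow> bool" where
  "J_ar_step n lt H H' \<longleftrightarrow> (\<exists>h\<in>H. \<exists>r. NF_J n lt (H - {h}) h r \<and>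
      H' = (if r = 0 then H - {h} else insert r (H - {h})))"

definition autoreduce_J :: "nat \<Rightarrow> (mono \<Rightarrow> mono \<Rightarrow> bool) \<Rightarrow> ('a::field) mpoly set \<Rightarrow> 'a mpoly set \<Rightarrow> bool" where
  "autoreduce_J n lt H G \<longleftrightarrow> (J_ar_step n lt)\<^sup>*\<^sup>* H G \<and> J_autoreduced n lt G"

text \<open>one pass of the inner while loop: move h from H to G\<close>
definition pj_move :: "nat \<Rightarrow> (mono \<Rightarrow> mono \<Rightarrow> bool) \<Rightarrow> ('a::zero) mpoly set \<times> 'a mpoly set \<Rightarrow> 'a mpoly set \<times> 'a mpoly set \<Rightarrow> bool" where
  "pj_move n lt GH GH' \<longleftrightarrow> (\<exists>h\<in>snd GH. lm lt h \<in> C_P n (lm lt ` (snd GH - {h})) \<and>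
      GH' = (insert h (fst GH), snd GH - {h}))"

inductive pj_for :: "nat \<Rightarrow> (mono \<Rightarrow> mono \<Rightarrow> bool) \<Rightarrow> ('a::field) mpoly set \<Rightarrow> 'a mpoly list \<Rightarrow> 'a mpoly set \<Rightarrow> bool"
  for n lt where
  pj_for_Nil: "pj_for n lt H [] H"
| pj_for_Cons: "NF_J n lt H g f \<Longrightarrow> pj_for n lt (if f = 0 then H else insert f H) gs H' \<Longrightarrow>
      pj_for n lt H (g # gs) H'"

definition pj_iter :: "nat \<Rightarrow> (mono \<Rightarrow> mono \<Rightarrow> bool) \<Rightarrow> ('a::field) mpoly set \<Rightarrow> 'a mpoly set \<Rightarrow> bool" where
  "pj_iter n lt H H' \<longleftrightarrow> (\<exists>G H1 gs. (pj_move n lt)\<^sup>*\<^sup>* ({}, H) (G, H1) \<and>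
      \<not> (\<exists>h\<in>H1. lm lt h \<in> C_P n (lm lt ` (H1 - {h}))) \<and>
      distinct gs \<and> set gs = G \<and> pj_for n lt H1 gs H')"

inductive pj_loop :: "nat \<Rightarrow> (mono \<Rightarrow> mono \<Rightarrow> bool) \<Rightarrow> ('a::field) mpoly set \<Rightarrow> 'a mpoly set \<Rightarrow> bool"
  for n lt where
  pj_stop: "pj_iter n lt H H \<Longrightarrow> pj_loop n lt H H"
| pj_continue: "pj_iter n lt H H' \<Longrightarrow> H' \<noteq> H \<Longrightarrow> pj_loop n lt H' H'' \<Longrightarrow> pj_loop n lt H H''"

definition autoreduce_PJ :: "nat \<Rightarrow> (mono \<Rightarrow> mono \<Rightarrow> bool) \<Rightarrow> ('a::field) mpoly set \<Rightarrow> 'a mpoly set \<Rightarrow> bool" where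
  "autoreduce_PJ n lt F G \<longleftrightarrow> (\<exists>H. pj_loop n lt F H \<and> autoreduce_J n lt H G)"

end

theory Submission
  imports Defs Complex_Main
begin

text \<open>Let \<open>M\<close> be the set of leading monomials of \<open>I\<close> and let \<open>H\<close> consist of those \<open>u\<close> in \<open>M\<close> that leave \<open>M\<close>
  when divided by their last variable (or are \<open>1\<close>). Both divisions are continuous, so the local
  conditions on nonmultiplicative prolongations imply that the involutive cones of the leading monomials
  of a basis cover \<open>M\<close>. For the Pommaret division this forces the leading monomials to be exactly \<open>H\<close>;
  hence a finite Pommaret basis exists iff \<open>H\<close> is finite.

  If \<open>H\<close> is finite, then Pommaret multiplicative variables are Janet multiplicative with respect to \<open>H\<close>,
  so \<open>H\<close> is Janet complete, and every Janet complete subset of \<open>M\<close> contains \<open>H\<close>. Thus \<open>H\<close> is also the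
  set of leading monomials of the minimal Janet bases. Applied to a Janet basis \<open>F\<close>, the algorithm moves
  away exactly the elements whose leading monomial is not in \<open>H\<close>, all of them have normal form zero
  modulo the rest, and the final autoreduction finds nothing to do.\<close>

section \<open>Monomials and polynomials\<close>

\<comment> \<open>Normal forms and both algorithms are relations, so every claim about them must
  hold for all sequences of choices. What is independent of the choices: input and result of a
  reduction differ by a linear combination of multiplicative prolongations. Hence modulo a complete
  subset of \<open>I\<close> every element of \<open>I\<close> has 0 as its only normal form. To
  pass between polynomials and monomials, leading monomials must be distinct and no tail term may
  lie in \<open>M\<close>; then the algorithm only selects elements of \<open>F\<close> and creates
  no new ones.

  A finite Janet complete set cannot contain an infinite \<open>H\<close>, so the inclusion of
  \<open>H\<close> has to exploit finiteness. It does so through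
  \<open>pom_gens_finite_prefix\<close>: an element of \<open>M\<close> may be cut after any
  variable \<open>x_i\<close>, once its exponent at \<open>x_i\<close> has been raised. The Janet
  divisor of such a monomial lacks the last variable of the generator under study, and a divisor of
  a generator inside \<open>M\<close> can never lack that variable.\<close>
alias keys = Poly_Mapping.keys
alias lookup = Poly_Mapping.lookup
alias single = Poly_Mapping.single

lemma mons_iff: "u \<in> mons n \<longleftrightarrow> (\<forall>i. i \<notin> {1..n} \<longrightarrow> deg i u = 0)"
  by (auto simp: mons_def in_keys_iff subset_iff)

lemma zero_in_mons [simp]: "0 \<in> mons n"
  by (simp add: mons_iff)

lemma mons_add_iff [simp]: "u + v \<in> mons n \<longleftrightarrow> u \<in> mons n \<and> v \<in> mons n"
  by (auto simp: mons_iff lookup_add)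

lemma var_in_mons [simp]: "i \<in> {1..n} \<Longrightarrow> var i \<in> mons n"
  by (auto simp: mons_iff var_def lookup_single when_def)

lemma deg_var: "deg j (var i) = (if j = i then 1 else 0)"
  by (simp add: var_def lookup_single when_def)

lemma mono_split:
  fixes u w :: mono
  assumes "\<And>i. deg i u \<le> deg i w"
  obtains v where "w = u + v" and "\<And>i. deg i v = deg i w - deg i u"
proof
  show "w = u + (w - u)"
    using assms by (intro poly_mapping_eqI) (simp add: lookup_add lookup_minus)
qed (simp add: lookup_minus)

lemma mono_split_var:
  assumes "deg i w > 0"
  obtains v where "w = var i + v" and "\<And>j. deg j v = deg j w - (if j = i then 1 else 0)"
proof (rule mono_split[of "var i" w])
  show "deg j (var i) \<le> deg j w" for j
    using assms by (auto simp: deg_var)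
qed (auto simp: deg_var intro: that)

section \<open>Dickson's lemma\<close>

lemma nat_seq_nondecreasing_subseq:
  fixes s :: "nat \<Rightarrow> nat"
  obtains f :: "nat \<Rightarrow> nat" where "strict_mono f" "\<And>i j. i \<le> j \<Longrightarrow> s (f i) \<le> s (f j)"
proof -
  obtain f where f: "strict_mono f" "monoseq (\<lambda>n. s (f n))"
    using seq_monosub by blast
  from f(2) show ?thesis
    unfolding monoseq_iff
  proof
    assume "incseq (\<lambda>n. s (f n))"
    then show ?thesis using f(1) that by (metis incseqD)
  next
    assume dec: "decseq (\<lambda>n. s (f n))"
    \<comment> \<open>A decreasing sequence of naturals is constant from its minimum on, so the tail
      after \<open>k\<close> serves as the nondecreasing subsequence.\<close>
    obtain k where k: "\<And>j. s (f k) \<le> s (f j)"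
      using ex_has_least_nat[of "\<lambda>_. True" 0 "\<lambda>n. s (f n)"] by auto
    have "s (f (k + i)) = s (f k)" for i
      using decseqD[OF dec, of k "k + i"] k[of "k + i"] by simp
    then show ?thesis
      using f(1) by (intro that[of "\<lambda>i. f (k + i)"]) (auto simp: strict_mono_def)
  qed
qed

text \<open>A whole subsequence, rather than one comparable pair, is what the induction on the
  number of coordinates needs: it can be thinned out again for the next coordinate.\<close>

lemma dickson_subseq:
  fixes s :: "nat \<Rightarrow> mono"
  obtains f :: "nat \<Rightarrow> nat" where "strict_mono f" "\<And>i j l. (i::nat) \<le> j \<Longrightarrow> l \<in> {1..k} \<Longrightarrow> deg l (s (f i)) \<le> deg l (s (f j))"
proof (induction k arbitrary: thesis)
  case 0
  show ?case by (rule 0[of "\<lambda>i. i"]) (auto simp: strict_mono_def)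
next
  case (Suc k)
  obtain f :: "nat \<Rightarrow> nat" where f: "strict_mono f"
    "\<And>i j l. (i::nat) \<le> j \<Longrightarrow> l \<in> {1..k} \<Longrightarrow> deg l (s (f i)) \<le> deg l (s (f j))"
    using Suc.IH by blast
  obtain g :: "nat \<Rightarrow> nat" where g: "strict_mono g" "\<And>i j. i \<le> j \<Longrightarrow> deg (Suc k) (s (f (g i))) \<le> deg (Suc k) (s (f (g j)))"
    using nat_seq_nondecreasing_subseq[of "\<lambda>i. deg (Suc k) (s (f i))"] by blast
  show ?case
  proof (rule Suc.prems[of "f \<circ> g"])
    show "strict_mono (f \<circ> g)"
      using f(1) g(1) by (simp add: strict_mono_def)
    show "deg l (s ((f \<circ> g) i)) \<le> deg l (s ((f \<circ> g) j))" if "i \<le> j" "l \<in> {1..Suc k}" for i j l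
      using that f(2)[of "g i" "g j" l] g(2)[of i j] strict_mono_less_eq[OF g(1)]
      by (cases "l = Suc k") auto
  qed
qed

lemma dickson_comparable_pair:
  fixes s :: "nat \<Rightarrow> mono"
  assumes "\<And>i. s i \<in> mons n"
  obtains i j v where "i < j" "s j = s i + v" "v \<in> mons n"
proof -
  obtain f :: "nat \<Rightarrow> nat" where f: "strict_mono f"
    "\<And>i j l. (i::nat) \<le> j \<Longrightarrow> l \<in> {1..n} \<Longrightarrow> deg l (s (f i)) \<le> deg l (s (f j))"
    using dickson_subseq[of n s] by blast
  have "deg l (s (f 0)) \<le> deg l (s (f 1))" for l :: nat
    using f(2)[of 0 1 l] assms by (cases "l \<in> {1..n}") (auto simp: mons_iff)
  then obtain v where "s (f 1) = s (f 0) + v" by (rule mono_split)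
  moreover from this have "v \<in> mons n" using assms[of "f 1"] by simp
  moreover have "f 0 < f 1" using f(1) by (simp add: strict_mono_def)
  ultimately show ?thesis using that by blast
qed

section \<open>Supports of sums and products\<close>

lemma polys_iff: "p \<in> polys n \<longleftrightarrow> (\<forall>t\<in>keys p. t \<in> mons n)"
  by (auto simp: polys_def)

lemma polys_zero [simp]: "0 \<in> polys n"
  by (simp add: polys_def)

lemma polys_diff:
  fixes p q :: "('a::ab_group_add) mpoly"
  shows "p \<in> polys n \<Longrightarrow> q \<in> polys n \<Longrightarrow> p - q \<in> polys n"
  using keys_add[of p "- q"] by (auto simp: polys_iff in_keys_iff subset_iff)

lemma polys_add:
  fixes p q :: "('a::monoid_add) mpoly"
  shows "p \<in> polys n \<Longrightarrow> q \<in> polys n \<Longrightarrow> p + q \<in> polys n"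
  using keys_add[of p q] by (auto simp: polys_iff)

lemma polys_mult:
  fixes p q :: "('a::semiring_0) mpoly"
  shows "p \<in> polys n \<Longrightarrow> q \<in> polys n \<Longrightarrow> p * q \<in> polys n"
  using keys_mult[of p q] by (fastforce simp: polys_iff)

lemma polys_single: "w \<in> mons n \<Longrightarrow> single w c \<in> polys n"
  by (auto simp: polys_iff)

lemma poly_sum_monomials:
  fixes p :: "('a::comm_monoid_add) mpoly"
  shows "p = (\<Sum>t\<in>keys p. single t (lookup p t))"
  by (rule poly_mapping_eqI) (simp add: lookup_sum lookup_single when_def in_keys_iff)

lemma single_mult_expand:
  fixes f :: "('a::semiring_0) mpoly"
  shows "single w c * f = (\<Sum>t\<in>keys f. single (w + t) (c * lookup f t))"
  by (subst poly_sum_monomials[of f]) (simp add: sum_distrib_left mult_single)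

lemma lookup_single_mult:
  fixes f :: "('a::semiring_0) mpoly"
  shows "lookup (single w c * f) (w + t) = c * lookup f t"
proof -
  have "lookup (single w c * f) (w + t)
      = (\<Sum>s\<in>keys f. if s = t then c * lookup f s else 0)"
    unfolding single_mult_expand lookup_sum by (intro sum.cong) (auto simp: lookup_single when_def)
  then show ?thesis by (simp add: in_keys_iff)
qed

lemma keys_single_mult:
  fixes f :: "('a::semiring_0) mpoly"
  shows "keys (single w c * f) \<subseteq> (+) w ` keys f"
  using keys_mult[of "single w c" f] by (auto split: if_splits)

section \<open>Involutive reduction\<close>

text \<open>With constants acting as \<open>single 0 c\<close>, an involutive representation (a
  combination of multiplicative prolongations with constant coefficients) becomes membership in a
  linear span, which comes with its own induction rules.\<close>

interpretation mpoly: vector_space "\<lambda>c (p :: ('a::field) mpoly). single 0 c * p"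
  by unfold_locales
    (simp_all add: distrib_left single_add distrib_right mult.assoc[symmetric] mult_single)

section \<open>Ideals\<close>

lemma gen_ideal_is_ideal:
  fixes F :: "('a::comm_ring_1) mpoly set"
  assumes "F \<subseteq> polys n"
  shows "is_ideal n (gen_ideal n F)"
  unfolding is_ideal_def
proof (intro conjI ballI subsetI)
  fix p assume "p \<in> gen_ideal n F"
  then obtain S q where p: "finite S" "S \<subseteq> F" "\<And>f. f \<in> S \<Longrightarrow> q f \<in> polys n" "p = (\<Sum>f\<in>S. q f * f)"
    by (auto simp: gen_ideal_def)
  from p(1-3) have "(\<Sum>f\<in>S. q f * f) \<in> polys n"
    using assms by (induction S) (auto intro!: polys_add polys_mult)
  with p(4) show "p \<in> polys n" by simp
  fix r :: "'a mpoly" assume "r \<in> polys n"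
  then show "r * p \<in> gen_ideal n F"
    using p unfolding gen_ideal_def
    by (intro CollectI exI[of _ S] exI[of _ "\<lambda>f. r * q f"])
       (auto simp: sum_distrib_left mult.assoc intro: polys_mult)
next
  show "0 \<in> gen_ideal n F"
    unfolding gen_ideal_def by (intro CollectI exI[of _ "{}"]) auto
next
  fix p p' assume "p \<in> gen_ideal n F" "p' \<in> gen_ideal n F"
  then obtain S q S' q' where
    p: "finite S" "S \<subseteq> F" "\<And>f. f \<in> S \<Longrightarrow> q f \<in> polys n" "p = (\<Sum>f\<in>S. q f * f)" and
    p': "finite S'" "S' \<subseteq> F" "\<And>f. f \<in> S' \<Longrightarrow> q' f \<in> polys n" "p' = (\<Sum>f\<in>S'. q' f * f)"
    unfolding gen_ideal_def by blast
  define h where "h f = (if f \<in> S then q f else 0) + (if f \<in> S' then q' f else 0)" for f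
  have "(\<Sum>f\<in>S \<union> S'. h f * f)
      = (\<Sum>f\<in>S \<union> S'. if f \<in> S then q f * f else 0) + (\<Sum>f\<in>S \<union> S'. if f \<in> S' then q' f * f else 0)"
    unfolding h_def sum.distrib[symmetric] by (intro sum.cong) (auto simp: distrib_right)
  also have "\<dots> = p + p'"
    using p(1,4) p'(1,4) by (simp add: sum.inter_restrict[symmetric] Int_absorb1)
  finally show "p + p' \<in> gen_ideal n F"
    using p p' unfolding gen_ideal_def
    by (intro CollectI exI[of _ "S \<union> S'"] exI[of _ h]) (auto simp: h_def intro: polys_add)
qed

lemma gen_ideal_least:
  assumes "is_ideal n I" "F \<subseteq> I"
  shows "gen_ideal n F \<subseteq> I"
proof
  fix p assume "p \<in> gen_ideal n F"
  then obtain S q where p: "finite S" "S \<subseteq> F" "\<And>f. f \<in> S \<Longrightarrow> q f \<in> polys n" "p = (\<Sum>f\<in>S. q f * f)"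
    by (auto simp: gen_ideal_def)
  from p(1-3) have "(\<Sum>f\<in>S. q f * f) \<in> I"
    using assms by (induction S) (auto simp: is_ideal_def)
  with p(4) show "p \<in> I" by simp
qed

lemma subset_gen_ideal: "F \<subseteq> gen_ideal n F" for F :: "('a::comm_ring_1) mpoly set"
proof
  fix f assume "f \<in> F"
  then show "f \<in> gen_ideal n F"
    unfolding gen_ideal_def
    by (intro CollectI exI[of _ "{f}"] exI[of _ "\<lambda>_. 1"]) (auto simp: polys_def)
qed

lemma ideal_diff:
  assumes "is_ideal n I" "p \<in> I" "q \<in> I"
  shows "p - q \<in> I"
proof -
  have "- 1 = (single 0 (- 1) :: 'a mpoly)"
    by (metis single_one single_uminus)
  then have "- 1 \<in> (polys n :: 'a mpoly set)"
    by (simp add: polys_single)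
  then have "- 1 * q \<in> I"
    using assms unfolding is_ideal_def by blast
  then have "p + - 1 * q \<in> I"
    using assms unfolding is_ideal_def by blast
  then show ?thesis by simp
qed

section \<open>Admissible orders and leading monomials\<close>

locale monomial_order =
  fixes n :: nat and lt :: "mono \<Rightarrow> mono \<Rightarrow> bool"
  assumes admissible: "admissible_order n lt"
begin

lemma lt_irrefl: "u \<in> mons n \<Longrightarrow> \<not> lt u u"
  using admissible by (simp add: admissible_order_def)

lemma lt_trans: "lt u v \<Longrightarrow> lt v w \<Longrightarrow> u \<in> mons n \<Longrightarrow> v \<in> mons n \<Longrightarrow> w \<in> mons n \<Longrightarrow> lt u w"
  using admissible unfolding admissible_order_def by (elim conjE) blast

lemma lt_total:
  assumes "u \<in> mons n" "v \<in> mons n"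
  shows "u = v \<or> lt u v \<or> lt v u"
proof -
  have "\<forall>u\<in>mons n. \<forall>v\<in>mons n. u \<noteq> v \<longrightarrow> lt u v \<or> lt v u"
    using admissible unfolding admissible_order_def by (elim conjE)
  then show ?thesis using assms by blast
qed

lemma lt_add:
  assumes "lt u v" "u \<in> mons n" "v \<in> mons n" "w \<in> mons n"
  shows "lt (w + u) (w + v)"
proof -
  have "\<forall>u\<in>mons n. \<forall>v\<in>mons n. \<forall>w\<in>mons n. lt u v \<longrightarrow> lt (u + w) (v + w)"
    using admissible unfolding admissible_order_def by (elim conjE)
  then have "lt (u + w) (v + w)" using assms by blast
  then show ?thesis by (simp add: add.commute)
qed

lemma lt_multiple:
  assumes "v \<noteq> 0" "u \<in> mons n" "v \<in> mons n"
  shows "lt u (u + v)"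
proof -
  have "\<forall>u\<in>mons n. u \<noteq> 0 \<longrightarrow> lt 0 u"
    using admissible unfolding admissible_order_def by (elim conjE)
  then show ?thesis using lt_add[of 0 v u] assms by simp
qed

text \<open>By Dickson's lemma some entry of a descending chain divides a later one and so cannot be
  above it. The relation is cut down to \<open>mons n\<close> because admissibility constrains
  \<open>lt\<close> only there.\<close>

lemma wf_lt: "wf {(u, v). u \<in> mons n \<and> v \<in> mons n \<and> lt u v}"
  unfolding wf_iff_no_infinite_down_chain
proof
  assume "\<exists>f. \<forall>i. (f (Suc i), f i) \<in> {(u, v). u \<in> mons n \<and> v \<in> mons n \<and> lt u v}"
  then obtain f where f: "\<And>i. f i \<in> mons n" "\<And>i. lt (f (Suc i)) (f i)"
    by blast
  have dec: "lt (f (i + Suc k)) (f i)" for i k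
  proof (induction k)
    case (Suc k)
    then show ?case using f(2)[of "i + Suc k"] f(1) lt_trans by fastforce
  qed (use f in simp)
  obtain i j v where ij: "i < j" "f j = f i + v" "v \<in> mons n"
    using dickson_comparable_pair[of f] f(1) by blast
  have less: "lt (f j) (f i)"
    using dec[of i "j - i - 1"] ij(1) by simp
  show False
  proof (cases "v = 0")
    case True
    then show ?thesis using less ij(2) lt_irrefl f(1) by simp
  next
    case False
    then show ?thesis using lt_multiple[of v "f i"] ij less f(1) lt_irrefl lt_trans by metis
  qed
qed

lemma finite_has_max:
  assumes "finite U" "U \<noteq> {}" "U \<subseteq> mons n"
  obtains u where "u \<in> U" "\<And>v. v \<in> U \<Longrightarrow> v \<noteq> u \<Longrightarrow> lt v u"
proof -
  have "\<exists>u\<in>U. \<forall>v\<in>U. v \<noteq> u \<longrightarrow> lt v u"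
    using assms
  proof (induction U rule: finite_ne_induct)
    case (insert x U)
    then obtain u where u: "u \<in> U" "\<And>v. v \<in> U \<Longrightarrow> v \<noteq> u \<Longrightarrow> lt v u" by auto
    show ?case
    proof (cases "lt u x")
      case True
      then have "lt v x" if "v \<in> U" for v
        using u that insert.prems lt_trans[of v u x] by (cases "v = u") auto
      then show ?thesis by auto
    next
      case False
      then have "lt x u" using lt_total[of x u] insert u(1) by auto
      then show ?thesis using u by auto
    qed
  qed simp
  then show ?thesis using that by blast
qed

lemma lm_eqI:
  assumes "p \<in> polys n" "u \<in> keys p" "\<And>v. v \<in> keys p \<Longrightarrow> v \<noteq> u \<Longrightarrow> lt v u"
  shows "lm lt p = u"
  unfolding lm_def
proof (rule the_equality)
  show "w = u" if "w \<in> keys p \<and> (\<forall>v\<in>keys p. v \<noteq> w \<longrightarrow> lt v w)" for w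
  proof (rule ccontr)
    assume "w \<noteq> u"
    then have "lt w u" using that assms(3) by blast
    moreover have "lt u w" using that assms(2) \<open>w \<noteq> u\<close> by auto
    ultimately show False using lt_trans lt_irrefl assms(1,2) that by (meson polys_iff)
  qed
qed (use assms in blast)

lemma
  assumes "p \<in> polys n" "p \<noteq> 0"
  shows lm_in_keys: "lm lt p \<in> keys p"
    and lm_max: "v \<in> keys p \<Longrightarrow> v \<noteq> lm lt p \<Longrightarrow> lt v (lm lt p)"
proof -
  obtain u where u: "u \<in> keys p" "\<And>v. v \<in> keys p \<Longrightarrow> v \<noteq> u \<Longrightarrow> lt v u"
    using finite_has_max[of "keys p"] assms by (auto simp: polys_def)
  then have "lm lt p = u" using lm_eqI assms(1) by blast
  then show "lm lt p \<in> keys p" "v \<in> keys p \<Longrightarrow> v \<noteq> lm lt p \<Longrightarrow> lt v (lm lt p)"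
    using u by auto
qed

lemma lm_in_mons: "p \<in> polys n \<Longrightarrow> p \<noteq> 0 \<Longrightarrow> lm lt p \<in> mons n"
  using lm_in_keys by (auto simp: polys_iff)

lemma lc_nonzero: "p \<in> polys n \<Longrightarrow> p \<noteq> 0 \<Longrightarrow> lc lt p \<noteq> 0"
  using lm_in_keys by (auto simp: lc_def in_keys_iff)

lemma lm_single_mult:
  fixes f :: "('a::field) mpoly"
  assumes "f \<in> polys n" "f \<noteq> 0" "w \<in> mons n" "c \<noteq> 0"
  shows "lm lt (single w c * f) = w + lm lt f"
proof (rule lm_eqI)
  show "single w c * f \<in> polys n"
    using assms by (simp add: polys_mult polys_single)
  show "w + lm lt f \<in> keys (single w c * f)"
    using assms lm_in_keys[OF assms(1,2)] by (simp add: in_keys_iff lookup_single_mult)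
  fix v assume v: "v \<in> keys (single w c * f)" "v \<noteq> w + lm lt f"
  then obtain s where s: "s \<in> keys f" "v = w + s"
    using keys_single_mult[of w c f] by blast
  then have "lt s (lm lt f)" using v(2) lm_max[OF assms(1,2)] by blast
  then show "lt v (w + lm lt f)"
    using s assms lm_in_mons[OF assms(1,2)] by (auto intro!: lt_add simp: polys_iff)
qed

text \<open>Such sets bound supports during reduction: cancelling a term inside \<open>B\<close>
  brings in only terms of \<open>B\<close>. The choice \<open>UNIV\<close> stands for no
  bound.\<close>

definition down_closed :: "mono set \<Rightarrow> bool" where
  "down_closed B \<longleftrightarrow> (\<forall>u\<in>B. \<forall>v\<in>mons n. u \<in> mons n \<longrightarrow> lt v u \<longrightarrow> v \<in> B)"

lemma keys_single_mult_down_closed: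
  fixes g :: "('a::field) mpoly"
  assumes "g \<in> polys n" "g \<noteq> 0" "w \<in> mons n" "down_closed B" "w + lm lt g \<in> B"
  shows "keys (single w c * g) \<subseteq> B"
proof
  fix v assume "v \<in> keys (single w c * g)"
  then obtain s where s: "s \<in> keys g" "v = w + s"
    using keys_single_mult[of w c g] by blast
  show "v \<in> B"
  proof (cases "s = lm lt g")
    case False
    then have "lt v (w + lm lt g)"
      using s assms lm_in_mons[OF assms(1,2)] lm_max[OF assms(1,2)] by (auto intro!: lt_add simp: polys_iff)
    moreover have "v \<in> mons n" "w + lm lt g \<in> mons n"
      using s assms lm_in_mons[OF assms(1,2)] by (auto simp: polys_iff)
    ultimately show ?thesis using assms(4,5) unfolding down_closed_def by blast
  qed (use s assms in simp)
qed

end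

section \<open>Reduction for an arbitrary assignment of multiplicative variables\<close>

definition inv_divides :: "(mono \<Rightarrow> nat set) \<Rightarrow> mono \<Rightarrow> mono \<Rightarrow> bool" where
  "inv_divides m u w \<longleftrightarrow> (\<exists>v. keys v \<subseteq> m u \<and> w = u + v)"

definition inv_red :: "(mono \<Rightarrow> nat set) \<Rightarrow> (mono \<Rightarrow> mono \<Rightarrow> bool) \<Rightarrow> ('a::field) mpoly set \<Rightarrow>
    'a mpoly \<Rightarrow> 'a mpoly \<Rightarrow> bool" where
  "inv_red m lt F p p' \<longleftrightarrow> (\<exists>t\<in>keys p. \<exists>g\<in>F. \<exists>v. t = lm lt g + v \<and> inv_divides m (lm lt g) t \<and>
       p' = p - single v (lookup p t / lc lt g) * g)"

definition inv_NF :: "(mono \<Rightarrow> nat set) \<Rightarrow> (mono \<Rightarrow> mono \<Rightarrow> bool) \<Rightarrow> ('a::field) mpoly set \<Rightarrow>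
    'a mpoly \<Rightarrow> 'a mpoly \<Rightarrow> bool" where
  "inv_NF m lt F p r \<longleftrightarrow> (inv_red m lt F)\<^sup>*\<^sup>* p r \<and>
     (\<forall>t\<in>keys r. \<forall>g\<in>F. \<not> inv_divides m (lm lt g) t)"

lemma P_divides_eq: "P_divides n = inv_divides (P_mult n)"
  by (simp add: fun_eq_iff P_divides_def inv_divides_def)

lemma J_divides_eq: "J_divides n U = inv_divides (J_mult n U)"
  by (simp add: fun_eq_iff J_divides_def inv_divides_def)

lemma NF_P_eq: "NF_P n lt F = inv_NF (P_mult n) lt F"
proof -
  have "P_red n lt F = inv_red (P_mult n) lt F"
    by (simp add: fun_eq_iff P_red_def inv_red_def P_divides_eq)
  then show ?thesis
    by (intro ext) (simp only: NF_P_def inv_NF_def P_divides_eq)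
qed

lemma NF_J_eq: "NF_J n lt F = inv_NF (J_mult n (lm lt ` F)) lt F"
proof -
  have "J_red n lt F = inv_red (J_mult n (lm lt ` F)) lt F"
    by (simp add: fun_eq_iff J_red_def inv_red_def J_divides_eq)
  then show ?thesis
    by (intro ext) (simp only: NF_J_def inv_NF_def J_divides_eq)
qed

text \<open>Both divisions are instances, the Janet division with its reference set of monomials
  frozen inside \<open>m\<close>. The set \<open>F\<close> may be infinite: taking all of
  \<open>I - {0}\<close> with every variable multiplicative gives ordinary reduction modulo an
  ideal, used in \<open>reduced_element_exists\<close>.\<close>

locale inv_division = monomial_order n lt for n lt +
  fixes m :: "mono \<Rightarrow> nat set" and F :: "('a::field) mpoly set"
  assumes F_polys: "F \<subseteq> polys n" and F_nonzero: "0 \<notin> F"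
    and mult_subset: "\<And>f. f \<in> F \<Longrightarrow> m (lm lt f) \<subseteq> {1..n}"
begin

lemma F_elemD: "f \<in> F \<Longrightarrow> f \<in> polys n" "f \<in> F \<Longrightarrow> f \<noteq> 0" "f \<in> F \<Longrightarrow> lm lt f \<in> mons n"
  using F_polys F_nonzero lm_in_mons by auto

lemma multiplier_mons: "f \<in> F \<Longrightarrow> keys w \<subseteq> m (lm lt f) \<Longrightarrow> w \<in> mons n"
  using mult_subset by (auto simp: mons_def)

text \<open>The bound \<open>B\<close> records how large the products in a representation get. The
  induction in \<open>mult_prolongation_in_span\<close> depends on it; \<open>UNIV\<close> forgets
  it.\<close>

definition prolongations :: "mono set \<Rightarrow> 'a mpoly set" where
  "prolongations B = {single w 1 * f | f w. f \<in> F \<and> keys w \<subseteq> m (lm lt f) \<and> w + lm lt f \<in> B}"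

lemma prolongations_mono: "B \<subseteq> B' \<Longrightarrow> prolongations B \<subseteq> prolongations B'"
  by (auto simp: prolongations_def)

lemma inv_red_span:
  assumes "inv_red m lt F p p'" "p \<in> polys n" "keys p \<subseteq> B" "down_closed B"
  shows "p' \<in> polys n \<and> keys p' \<subseteq> B \<and> p - p' \<in> mpoly.span (prolongations B)"
proof -
  obtain t g v where t: "t \<in> keys p" "g \<in> F" "t = lm lt g + v" "inv_divides m (lm lt g) t"
    and p': "p' = p - single v (lookup p t / lc lt g) * g"
    using assms(1) by (auto simp: inv_red_def)
  define c where "c = lookup p t / lc lt g"
  from t(3,4) have v: "keys v \<subseteq> m (lm lt g)"
    by (auto simp: inv_divides_def)
  have vm: "v \<in> mons n" using multiplier_mons[OF t(2) v] .
  have B: "v + lm lt g \<in> B" using t(1,3) assms(3) by (auto simp: add.commute)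
  have "p' \<in> polys n"
    unfolding p' using F_elemD(1)[OF t(2)] vm assms(2) by (intro polys_diff polys_mult polys_single)
  moreover have "keys p' \<subseteq> keys p \<union> keys (single v c * g)"
    unfolding p' c_def by (auto simp: in_keys_iff lookup_minus)
  then have "keys p' \<subseteq> B"
    using keys_single_mult_down_closed[OF F_elemD(1,2)[OF t(2) ] vm assms(4) B] assms(3) t(2) by blast
  moreover have "single 0 c * (single v 1 * g) \<in> mpoly.span (prolongations B)"
    using t(2) v B by (intro mpoly.span_scale mpoly.span_base) (auto simp: prolongations_def)
  then have "p - p' \<in> mpoly.span (prolongations B)"
    by (simp add: p' c_def mult.assoc[symmetric] mult_single)
  ultimately show ?thesis by blast
qed

lemma inv_reds_span:
  assumes "(inv_red m lt F)\<^sup>*\<^sup>* p r" "p \<in> polys n" "keys p \<subseteq> B" "down_closed B"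
  shows "r \<in> polys n \<and> keys r \<subseteq> B \<and> p - r \<in> mpoly.span (prolongations B)"
  using assms
proof (induction rule: rtranclp_induct)
  case base
  then show ?case by (simp add: mpoly.span_zero)
next
  case (step q r)
  then have "r \<in> polys n \<and> keys r \<subseteq> B \<and> q - r \<in> mpoly.span (prolongations B)"
    using inv_red_span by blast
  moreover have "p - q \<in> mpoly.span (prolongations B)" using step by blast
  ultimately show ?case
    using mpoly.span_add[of "p - q" _ "q - r"] by simp
qed

text \<open>It suffices to follow one strategy that stops: always cancel the largest reducible term.
  Each cancellation adds only terms below the cancelled one, so the largest reducible term goes down
  in a well-founded order.\<close>

lemma inv_NF_exists:
  assumes "p \<in> polys n"
  obtains r where "inv_NF m lt F p r"
proof -
  define reducible where "reducible t \<longleftrightarrow> (\<exists>g\<in>F. inv_divides m (lm lt g) t)" for t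
  have max: "\<exists>t. t \<in> keys p \<and> reducible t \<and> (\<forall>s\<in>keys p. reducible s \<longrightarrow> s \<noteq> t \<longrightarrow> lt s t)"
    if "p \<in> polys n" "\<exists>t\<in>keys p. reducible t" for p :: "'a mpoly"
  proof -
    obtain t where "t \<in> {t\<in>keys p. reducible t}" "\<And>v. v \<in> {t\<in>keys p. reducible t} \<Longrightarrow> v \<noteq> t \<Longrightarrow> lt v t"
    proof (rule finite_has_max)
      show "{t\<in>keys p. reducible t} \<subseteq> mons n" using \<open>p \<in> polys n\<close> by (auto simp: polys_def)
      show "{t\<in>keys p. reducible t} \<noteq> {}" using \<open>\<exists>t\<in>keys p. reducible t\<close> by blast
    qed auto
    then show ?thesis by blast
  qed
  have NF: "\<exists>r. inv_NF m lt F p r"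
    if "t \<in> keys p" "reducible t" "\<forall>s\<in>keys p. reducible s \<longrightarrow> s \<noteq> t \<longrightarrow> lt s t" "p \<in> polys n" for t p
    using that
  proof (induction t arbitrary: p rule: wf_induct_rule[OF wf_lt])
    case (1 t)
    then obtain g v where g: "g \<in> F" "t = lm lt g + v" "inv_divides m (lm lt g) t"
      by (auto simp: reducible_def inv_divides_def)
    then have v: "v \<in> mons n"
      by (auto simp: inv_divides_def intro: multiplier_mons)
    note gD = F_elemD[OF g(1)]
    define c where "c = lookup p t / lc lt g"
    define p' where "p' = p - single v c * g"
    have red: "inv_red m lt F p p'"
      unfolding inv_red_def p'_def c_def using 1 g by blast
    then have p': "p' \<in> polys n"
      using inv_red_span[of p p' UNIV] 1(5) by (simp add: down_closed_def)
    have "lookup p' t = 0"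
      using lc_nonzero[OF gD(1,2)] lookup_single_mult[of v c g "lm lt g"]
      by (simp add: p'_def lookup_minus c_def g(2) add.commute lc_def)
    then have below: "lt s t" if "s \<in> keys p'" "reducible s" for s
    proof (cases "s \<in> keys p")
      case True
      then show ?thesis using 1(4) that \<open>lookup p' t = 0\<close> by (auto simp: in_keys_iff)
    next
      case False
      then have "s \<in> keys (single v c * g)" using that(1)
        by (auto simp: p'_def lookup_minus in_keys_iff)
      then have "s \<in> {s \<in> mons n. s = t \<or> lt s t}"
        using keys_single_mult_down_closed[OF gD(1,2) v, of "{s \<in> mons n. s = t \<or> lt s t}" c] gD(3) v lt_trans[of _ _ t]
        by (auto simp: down_closed_def g(2) add.commute)
      then show ?thesis using that \<open>lookup p' t = 0\<close> by (auto simp: in_keys_iff)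
    qed
    show ?case
    proof (cases "\<exists>s\<in>keys p'. reducible s")
      case True
      then obtain s where s: "s \<in> keys p'" "reducible s" "\<forall>s'\<in>keys p'. reducible s' \<longrightarrow> s' \<noteq> s \<longrightarrow> lt s' s"
        using max[OF p'] by blast
      then have "(s, t) \<in> {(u, v). u \<in> mons n \<and> v \<in> mons n \<and> lt u v}"
        using below p' 1 by (auto simp: polys_iff)
      then obtain r where "inv_NF m lt F p' r"
        using 1(1) s p' by blast
      then show ?thesis
        using red by (auto simp: inv_NF_def intro: converse_rtranclp_into_rtranclp)
    next
      case False
      then show ?thesis using red by (auto simp: inv_NF_def reducible_def)
    qed
  qed
  show ?thesis
  proof (cases "\<exists>t\<in>keys p. reducible t")
    case True
    then show ?thesis using max[OF assms] NF assms that by blast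
  next
    case False
    then have "inv_NF m lt F p p" by (auto simp: inv_NF_def reducible_def)
    then show ?thesis using that by blast
  qed
qed

definition disjoint_cones :: bool where
  "disjoint_cones \<longleftrightarrow> (\<forall>f\<in>F. \<forall>g\<in>F. \<forall>w. inv_divides m (lm lt f) w \<longrightarrow> inv_divides m (lm lt g) w \<longrightarrow> f = g)"

text \<open>Disjoint cones give distinct prolongations distinct leading monomials, so the largest of
  them cannot cancel in a linear combination and is the leading monomial of the sum.\<close>

lemma span_lm:
  assumes "disjoint_cones" "p \<in> mpoly.span (prolongations UNIV)" "p \<noteq> 0"
  shows "\<exists>f\<in>F. inv_divides m (lm lt f) (lm lt p)"
proof -
  obtain T c where T: "finite T" "T \<subseteq> prolongations UNIV" "p = (\<Sum>a\<in>T. single 0 (c a) * a)"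
    using assms(2) unfolding mpoly.span_explicit by blast
  \<comment> \<open>Terms with coefficient 0 are dropped first, since the maximum is taken over the
    summands that really occur.\<close>
  define T' where "T' = {a \<in> T. c a \<noteq> 0}"
  have T': "finite T'" "T' \<subseteq> prolongations UNIV" "p = (\<Sum>a\<in>T'. single 0 (c a) * a)"
    using T unfolding T'_def by (auto intro!: sum.mono_neutral_right)
  have gen: "\<exists>f w. f \<in> F \<and> w \<in> mons n \<and> keys w \<subseteq> m (lm lt f) \<and> a = single w 1 * f \<and> lm lt a = w + lm lt f"
    if "a \<in> prolongations UNIV" for a
    using that multiplier_mons lm_single_mult[OF F_elemD(1,2)] unfolding prolongations_def by fastforce
  have pol: "a \<in> polys n" "a \<noteq> 0" if a: "a \<in> prolongations UNIV" for a
  proof -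
    obtain f w where fw: "f \<in> F" "w \<in> mons n" "a = single w 1 * f" using gen[OF a] by blast
    then show "a \<in> polys n" using F_elemD by (simp add: polys_mult polys_single)
    have "lookup a (w + lm lt f) \<noteq> 0"
      using fw(3) lc_nonzero[OF F_elemD(1,2)[OF fw(1)]] fw(1) by (simp add: lookup_single_mult lc_def)
    then show "a \<noteq> 0" by auto
  qed
  have inj: "a = b" if ab: "a \<in> prolongations UNIV" "b \<in> prolongations UNIV" "lm lt a = lm lt b" for a b
  proof -
    obtain f w where f: "f \<in> F" "keys w \<subseteq> m (lm lt f)" "a = single w 1 * f" "lm lt a = w + lm lt f"
      using gen[OF ab(1)] by blast
    obtain g v where g: "g \<in> F" "keys v \<subseteq> m (lm lt g)" "b = single v 1 * g" "lm lt b = v + lm lt g"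
      using gen[OF ab(2)] by blast
    have "inv_divides m (lm lt f) (lm lt a)" "inv_divides m (lm lt g) (lm lt a)"
      using f g ab(3) by (auto simp: inv_divides_def add.commute)
    then have "f = g" using assms(1) f(1) g(1) unfolding disjoint_cones_def by blast
    then show ?thesis using f g ab(3) by simp
  qed
  have "T' \<noteq> {}" using T'(3) assms(3) by auto
  then obtain u where u: "u \<in> lm lt ` T'" "\<And>v. v \<in> lm lt ` T' \<Longrightarrow> v \<noteq> u \<Longrightarrow> lt v u"
    using finite_has_max[of "lm lt ` T'"] T'(1,2) lm_in_mons pol by blast
  then obtain a where a: "a \<in> T'" "u = lm lt a" by blast
  note aD = pol[OF subsetD[OF T'(2) a(1)]]
  have small: "v = u \<or> lt v u" "v \<in> keys b" "b = a \<or> v \<noteq> u" if "b \<in> T'" "v \<in> keys (single 0 (c b) * b)" for b v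
  proof -
    note bD = pol[OF subsetD[OF T'(2) that(1)]]
    show v: "v \<in> keys b" using that(2) keys_single_mult[of 0 "c b" b] by auto
    have b: "lm lt b = u \<or> lt (lm lt b) u" using u that(1) by blast
    have v': "v = lm lt b \<or> lt v (lm lt b)" using lm_max[OF bD v] by blast
    have mons: "v \<in> mons n" "lm lt b \<in> mons n" "u \<in> mons n"
      using v bD aD a(2) lm_in_mons by (auto simp: polys_iff)
    show "v = u \<or> lt v u" using b v' mons lt_trans by metis
    show "b = a \<or> v \<noteq> u"
    proof (rule ccontr)
      assume "\<not> (b = a \<or> v \<noteq> u)"
      then have "v = u" "b \<noteq> a" by auto
      then have "lm lt b \<noteq> u" using inj[of b a] a T'(2) that(1) by auto
      then show False using b v' \<open>v = u\<close> mons lt_trans lt_irrefl by metis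
    qed
  qed
  have "lookup p u = (\<Sum>b\<in>T'. if b = a then c a * lookup a u else 0)"
    unfolding T'(3) lookup_sum
  proof (intro sum.cong refl)
    fix b assume "b \<in> T'"
    have "lookup (single 0 (c b) * b) u = c b * lookup b u"
      using lookup_single_mult[of 0 "c b" b u] by simp
    moreover have "lookup (single 0 (c b) * b) u = 0" if "b \<noteq> a"
      using small(3)[OF \<open>b \<in> T'\<close>, of u] that by (metis in_keys_iff)
    ultimately show "lookup (single 0 (c b) * b) u = (if b = a then c a * lookup a u else 0)"
      by simp
  qed
  also have "\<dots> = c a * lookup a u" using a(1) T'(1) by simp
  also have "\<dots> \<noteq> 0" using a lm_in_keys[OF aD] by (auto simp: T'_def in_keys_iff)
  finally have "u \<in> keys p" by (simp add: in_keys_iff)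
  moreover have "lt v u" if "v \<in> keys p" "v \<noteq> u" for v
  proof -
    have "\<exists>b\<in>T'. v \<in> keys (single 0 (c b) * b)"
    proof (rule ccontr)
      assume "\<not> ?thesis"
      then have "lookup p v = 0" unfolding T'(3) lookup_sum by (auto simp: in_keys_iff intro!: sum.neutral)
      then show False using that(1) by (simp add: in_keys_iff)
    qed
    then show ?thesis using small(1) that(2) by blast
  qed
  moreover have "p \<in> polys n"
  proof -
    have "v \<in> mons n" if "v \<in> keys p" for v
    proof (rule ccontr)
      assume nv: "v \<notin> mons n"
      have "v \<notin> keys (single 0 (c b) * b)" if "b \<in> T'" for b
        using small(2)[OF that] pol[OF subsetD[OF T'(2) that]] nv by (auto simp: polys_iff)
      then have "lookup p v = 0" unfolding T'(3) lookup_sum by (auto simp: in_keys_iff intro!: sum.neutral)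
      then show False using that by (simp add: in_keys_iff)
    qed
    then show ?thesis by (simp add: polys_iff)
  qed
  ultimately have "lm lt p = u" by (intro lm_eqI)
  moreover obtain f w where "f \<in> F" "keys w \<subseteq> m (lm lt f)" "lm lt a = w + lm lt f"
    using gen[OF subsetD[OF T'(2) a(1)]] by blast
  ultimately show ?thesis using a(2) by (auto simp: inv_divides_def add.commute)
qed

end

context monomial_order
begin

definition below :: "mono \<Rightarrow> mono set" where
  "below t = {v \<in> mons n. v = t \<or> lt v t}"

lemma down_closed_below: "t \<in> mons n \<Longrightarrow> down_closed (below t)"
  unfolding down_closed_def below_def using lt_trans by blast

lemma keys_below: "p \<in> polys n \<Longrightarrow> keys p \<subseteq> below (lm lt p)"
proof
  fix v assume "p \<in> polys n" "v \<in> keys p"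
  then show "v \<in> below (lm lt p)"
    using lm_max[of p v] by (cases "p = 0") (auto simp: below_def polys_iff)
qed

lemma below_mono: "u \<in> below t \<Longrightarrow> t \<in> mons n \<Longrightarrow> below u \<subseteq> below t"
  unfolding below_def using lt_trans by blast

end

section \<open>From nonmultiplicative prolongations to the whole ideal\<close>

context inv_division
begin

text \<open>Induction on the product \<open>w + lm lt f\<close> and, inside, on \<open>lm lt f\<close> along \<open>R\<close>: replacing a
  nonmultiplicative prolongation by its involutive representation leaves the product unchanged only in
  the top term, and there \<open>R\<close> goes down.\<close>

lemma mult_prolongation_in_span:
  assumes "wf R"
    and cont: "\<And>f g i w. f \<in> F \<Longrightarrow> g \<in> F \<Longrightarrow> i \<in> {1..n} - m (lm lt f) \<Longrightarrow> keys w \<subseteq> m (lm lt g) \<Longrightarrow>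
       lm lt f + var i = lm lt g + w \<Longrightarrow> (lm lt g, lm lt f) \<in> R"
    and involutive: "\<And>f i r. f \<in> F \<Longrightarrow> i \<in> {1..n} - m (lm lt f) \<Longrightarrow>
       inv_NF m lt F (single (var i) 1 * f) r \<Longrightarrow> r = 0"
    and "f \<in> F" "w \<in> mons n"
  shows "single w 1 * f \<in> mpoly.span (prolongations (below (w + lm lt f)))"
  using assms(4,5)
proof (induction "(w + lm lt f, lm lt f)" arbitrary: w f
    rule: wf_induct_rule[OF wf_lex_prod[OF wf_lt \<open>wf R\<close>]])
  case (1 w f)
  note fD = F_elemD[OF 1(2)]
  define t where "t = w + lm lt f"
  have t: "t \<in> mons n" using 1(3) fD(3) by (simp add: t_def)
  show ?case
  proof (cases "keys w \<subseteq> m (lm lt f)")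
    case True
    then show ?thesis
      using 1(2,3) t by (intro mpoly.span_base) (auto simp: prolongations_def below_def t_def)
  next
    case False
    then obtain i where i: "i \<in> keys w" "i \<notin> m (lm lt f)" by blast
    then have "i \<in> {1..n}" using 1(3) by (auto simp: mons_def)
    with i have i': "i \<in> {1..n} - m (lm lt f)" by blast
    obtain w' where w': "w = var i + w'"
      using mono_split_var[of w i] i(1) by (auto simp: in_keys_iff)
    then have w'm: "w' \<in> mons n" using 1(3) by simp
    define xf where "xf = single (var i) 1 * f"
    have xf: "xf \<in> polys n" "lm lt xf = var i + lm lt f"
      using fD i' lm_single_mult[OF fD(1,2), of "var i" 1] by (simp_all add: xf_def polys_mult polys_single)
    obtain r where r: "inv_NF m lt F xf r" using inv_NF_exists[OF xf(1)] .
    then have "r = 0" using involutive 1(2) i' by (auto simp: xf_def)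
    moreover have "var i + lm lt f \<in> mons n" using fD(3) i' by simp
    ultimately have span: "xf \<in> mpoly.span (prolongations (below (var i + lm lt f)))"
      using inv_reds_span[of xf r "below (var i + lm lt f)"] r xf keys_below[OF xf(1)] down_closed_below
      by (auto simp: inv_NF_def)
    have "single w' 1 * p \<in> mpoly.span (prolongations (below t))"
      if "p \<in> mpoly.span (prolongations (below (var i + lm lt f)))" for p
      using that
    proof (induction rule: mpoly.span_induct_alt)
      case base
      then show ?case by (simp add: mpoly.span_zero)
    next
      case (step c x y)
      obtain h v where h: "x = single v 1 * h" "h \<in> F" "keys v \<subseteq> m (lm lt h)" "v + lm lt h \<in> below (var i + lm lt f)"
        using step(1) by (auto simp: prolongations_def)
      have vm: "v \<in> mons n" "lm lt h \<in> mons n" using multiplier_mons h(2,3) F_elemD(3) by auto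
      define s where "s = (w' + v) + lm lt h"
      have s: "s \<in> mons n" using vm w'm by (simp add: s_def)
      have s_eq: "s = w' + (v + lm lt h)" and t_eq: "t = w' + (var i + lm lt f)"
        by (simp_all add: s_def t_def w' ac_simps)
      have i_mons: "var i + lm lt f \<in> mons n" using fD(3) i' by simp
      have "s = t \<and> (lm lt h, lm lt f) \<in> R \<or> lt s t"
      proof (cases "v + lm lt h = var i + lm lt f")
        case True
        then show ?thesis
          using cont[OF 1(2) h(2) i' h(3)] by (simp add: s_eq t_eq add.commute)
      next
        case False
        then have "lt (v + lm lt h) (var i + lm lt f)" using h(4) by (simp add: below_def)
        then show ?thesis using lt_add vm w'm i_mons by (simp add: s_eq t_eq)
      qed
      then have less: "((s, lm lt h), (w + lm lt f, lm lt f))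
          \<in> {(u, v). u \<in> mons n \<and> v \<in> mons n \<and> lt u v} <*lex*> R"
        and "s \<in> below t"
        using s t by (auto simp: t_def below_def)
      have "single (w' + v) 1 * h \<in> mpoly.span (prolongations (below s))"
        using 1(1)[of "w' + v" h] less h(2) vm w'm by (simp add: s_def)
      then have "single (w' + v) 1 * h \<in> mpoly.span (prolongations (below t))"
        using mpoly.span_mono[OF prolongations_mono[OF below_mono[OF \<open>s \<in> below t\<close> t]]] by blast
      then have "single 0 c * (single (w' + v) 1 * h) + single w' 1 * y \<in> mpoly.span (prolongations (below t))"
        using step(2) by (intro mpoly.span_add mpoly.span_scale)
      then show ?case
        by (simp add: h(1) distrib_left mult.assoc[symmetric] mult_single)
    qed
    then have "single w' 1 * xf \<in> mpoly.span (prolongations (below t))" using span by blast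
    then show ?thesis
      by (simp add: xf_def t_def w' mult.assoc[symmetric] mult_single add.commute)
  qed
qed

lemma gen_ideal_subset_span:
  assumes "\<And>f w. f \<in> F \<Longrightarrow> w \<in> mons n \<Longrightarrow> single w 1 * f \<in> mpoly.span (prolongations UNIV)"
    and "p \<in> gen_ideal n F"
  shows "p \<in> mpoly.span (prolongations UNIV)"
proof -
  obtain S q where S: "S \<subseteq> F" "\<And>f. f \<in> S \<Longrightarrow> q f \<in> polys n" "p = (\<Sum>f\<in>S. q f * f)"
    using assms(2) by (auto simp: gen_ideal_def)
  show ?thesis
    unfolding S(3)
  proof (rule mpoly.span_sum)
    fix f assume f: "f \<in> S"
    have "q f * f = (\<Sum>t\<in>keys (q f). single 0 (lookup (q f) t) * (single t 1 * f))"
      by (subst (1) poly_sum_monomials[of "q f"])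
        (simp add: sum_distrib_right mult.assoc[symmetric] mult_single)
    also have "\<dots> \<in> mpoly.span (prolongations UNIV)"
      using f S(1,2) assms(1) by (intro mpoly.span_sum mpoly.span_scale) (auto simp: polys_iff)
    finally show "q f * f \<in> mpoly.span (prolongations UNIV)" .
  qed
qed

text \<open>The relation \<open>R\<close> stays abstract here; for both divisions it becomes
  \<open>lex_greater\<close> on a finite set of leading monomials. The hypothesis
  \<open>cont\<close> is continuity of the division.\<close>

theorem involutive_basis_complete:
  assumes "wf R" disjoint_cones
    and cont: "\<And>f g i w. f \<in> F \<Longrightarrow> g \<in> F \<Longrightarrow> i \<in> {1..n} - m (lm lt f) \<Longrightarrow> keys w \<subseteq> m (lm lt g) \<Longrightarrow>
       lm lt f + var i = lm lt g + w \<Longrightarrow> (lm lt g, lm lt f) \<in> R"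
    and involutive: "\<And>f i r. f \<in> F \<Longrightarrow> i \<in> {1..n} - m (lm lt f) \<Longrightarrow>
       inv_NF m lt F (single (var i) 1 * f) r \<Longrightarrow> r = 0"
    and "p \<in> gen_ideal n F" "p \<noteq> 0"
  shows "\<exists>f\<in>F. inv_divides m (lm lt f) (lm lt p)"
proof (rule span_lm)
  show "p \<in> mpoly.span (prolongations UNIV)"
  proof (rule gen_ideal_subset_span[OF _ assms(5)])
    fix f w assume "f \<in> F" "w \<in> mons n"
    then have "single w 1 * f \<in> mpoly.span (prolongations (below (w + lm lt f)))"
      by (intro mult_prolongation_in_span[OF assms(1) cont involutive])
    then show "single w 1 * f \<in> mpoly.span (prolongations UNIV)"
      using mpoly.span_mono[OF prolongations_mono[of _ UNIV]] by blast
  qed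
qed (use assms in auto)

lemma span_subset_ideal:
  assumes "is_ideal n I" "F \<subseteq> I"
  shows "mpoly.span (prolongations UNIV) \<subseteq> I"
proof
  have mult: "single w c * f \<in> I" if "w \<in> mons n" "f \<in> I" for w c f
    using assms(1) that(2) polys_single[OF that(1), of c] unfolding is_ideal_def by blast
  fix p assume "p \<in> mpoly.span (prolongations UNIV)"
  then show "p \<in> I"
  proof (induction rule: mpoly.span_induct_alt)
    case base
    then show ?case using assms(1) by (simp add: is_ideal_def)
  next
    case (step c x y)
    then obtain f w where "x = single w 1 * f" "f \<in> F" "keys w \<subseteq> m (lm lt f)"
      by (auto simp: prolongations_def)
    then have "single 0 c * x \<in> I" using mult multiplier_mons assms(2) by auto
    then show ?case using step(2) assms(1) by (simp add: is_ideal_def)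
  qed
qed

text \<open>A normal form of an element of \<open>I\<close> stays in \<open>I\<close>; were it
  nonzero, completeness would make its leading monomial reducible.\<close>

lemma inv_NF_zero:
  assumes "is_ideal n I" "F \<subseteq> I"
    and complete: "\<And>p. p \<in> I \<Longrightarrow> p \<noteq> 0 \<Longrightarrow> \<exists>f\<in>F. inv_divides m (lm lt f) (lm lt p)"
    and "p \<in> I" "inv_NF m lt F p r"
  shows "r = 0"
proof (rule ccontr)
  assume "r \<noteq> 0"
  have p: "p \<in> polys n" using assms(1,4) by (auto simp: is_ideal_def)
  have reds: "(inv_red m lt F)\<^sup>*\<^sup>* p r" using assms(5) by (simp add: inv_NF_def)
  then have r: "r \<in> polys n" "p - r \<in> mpoly.span (prolongations UNIV)"
    using inv_reds_span[OF _ p, of r UNIV] by (auto simp: down_closed_def)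
  then have "p - r \<in> I" using span_subset_ideal[OF assms(1,2)] by blast
  then have "r \<in> I" using ideal_diff[OF assms(1,4)] by fastforce
  then show False
    using complete[of r] \<open>r \<noteq> 0\<close> lm_in_keys[OF r(1)] assms(5) by (auto simp: inv_NF_def)
qed

lemma gen_ideal_eq:
  assumes "is_ideal n I" "F \<subseteq> I"
    and complete: "\<And>p. p \<in> I \<Longrightarrow> p \<noteq> 0 \<Longrightarrow> \<exists>f\<in>F. inv_divides m (lm lt f) (lm lt p)"
  shows "gen_ideal n F = I"
proof
  show "gen_ideal n F \<subseteq> I" by (rule gen_ideal_least[OF assms(1,2)])
  show "I \<subseteq> gen_ideal n F"
  proof
    fix p assume p: "p \<in> I"
    then have "p \<in> polys n" using assms(1) by (auto simp: is_ideal_def)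
    then obtain r where r: "inv_NF m lt F p r" by (rule inv_NF_exists)
    then have "r = 0" using inv_NF_zero[OF assms(1,2) complete p] by blast
    then have "p \<in> mpoly.span (prolongations UNIV)"
      using r inv_reds_span[of p r UNIV] \<open>p \<in> polys n\<close> by (auto simp: inv_NF_def down_closed_def)
    then show "p \<in> gen_ideal n F"
      using span_subset_ideal[OF gen_ideal_is_ideal[OF F_polys] subset_gen_ideal] by blast
  qed
qed

end

section \<open>Janet and Pommaret division of monomials\<close>

definition mono_ideal :: "nat \<Rightarrow> mono set \<Rightarrow> bool" where
  "mono_ideal n M \<longleftrightarrow> M \<subseteq> mons n \<and> (\<forall>u\<in>M. \<forall>v\<in>mons n. u + v \<in> M)"

text \<open>The leading monomials of the only possible Pommaret basis: a monomial of the ideal is a generator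
  iff dividing it by its last variable leaves the ideal.\<close>

definition pom_gens :: "mono set \<Rightarrow> mono set" where
  "pom_gens M = {u \<in> M. u = 0 \<or> (\<forall>v. u = var (cls u) + v \<longrightarrow> v \<notin> M)}"

definition inv_complete :: "(mono \<Rightarrow> nat set) \<Rightarrow> mono set \<Rightarrow> mono set \<Rightarrow> bool" where
  "inv_complete m M U \<longleftrightarrow> (\<forall>w\<in>M. \<exists>u\<in>U. inv_divides m u w)"

lemma inv_divides_iff:
  "inv_divides m u w \<longleftrightarrow> (\<forall>i. deg i u \<le> deg i w) \<and> (\<forall>i. deg i u < deg i w \<longrightarrow> i \<in> m u)"
proof
  assume "inv_divides m u w"
  then obtain v where v: "keys v \<subseteq> m u" "w = u + v" by (auto simp: inv_divides_def)
  then show "(\<forall>i. deg i u \<le> deg i w) \<and> (\<forall>i. deg i u < deg i w \<longrightarrow> i \<in> m u)"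
    by (auto simp: lookup_add in_keys_iff subset_iff)
next
  assume *: "(\<forall>i. deg i u \<le> deg i w) \<and> (\<forall>i. deg i u < deg i w \<longrightarrow> i \<in> m u)"
  obtain v where "w = u + v" "\<And>i. deg i v = deg i w - deg i u"
    using mono_split[of u w] * by blast
  then show "inv_divides m u w"
    using * by (auto simp: inv_divides_def in_keys_iff intro!: exI[of _ v])
qed

lemma mono_eqI: "(\<And>i. deg i u = deg i v) \<Longrightarrow> u = v" for u v :: mono
  by (rule poly_mapping_eqI)

lemma inv_divides_refl [simp]: "inv_divides m u u"
  by (simp add: inv_divides_iff)

lemma mono_ideal_dvd:
  assumes "mono_ideal n M" "u \<in> M" "w \<in> mons n" "\<And>i. deg i u \<le> deg i w"
  shows "w \<in> M"
proof -
  obtain v where "w = u + v" using mono_split[of u w] assms(4) by blast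
  then show ?thesis using assms(1-3) by (auto simp: mono_ideal_def)
qed

lemma mono_truncate:
  fixes u :: mono
  obtains v where "\<And>j. deg j v = (if j \<le> i then deg j u else 0)"
proof -
  have "finite {j. (if j \<le> i then deg j u else 0) \<noteq> 0}"
    by (rule finite_subset[of _ "{..i}"]) auto
  then show ?thesis using that[of "Abs_poly_mapping (\<lambda>j. if j \<le> i then deg j u else 0)"] by simp
qed

lemma mono_first_difference:
  fixes u v :: mono
  assumes "u \<noteq> v"
  obtains i where "deg i u \<noteq> deg i v" "\<And>j. j < i \<Longrightarrow> deg j u = deg j v"
proof -
  have "\<exists>i. deg i u \<noteq> deg i v" using assms mono_eqI by blast
  then show ?thesis
    using that[of "LEAST i. deg i u \<noteq> deg i v"] LeastI_ex[of "\<lambda>i. deg i u \<noteq> deg i v"] not_less_Least by blast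
qed

lemma deg_gt_cls: "cls u < j \<Longrightarrow> deg j u = 0"
proof (rule ccontr)
  assume "cls u < j" "deg j u \<noteq> 0"
  then have "u \<noteq> 0" "j \<in> keys u" by (auto simp: in_keys_iff)
  then have "j \<le> cls u" by (simp add: cls_def)
  then show False using \<open>cls u < j\<close> by simp
qed

lemma deg_cls:
  assumes "u \<noteq> 0" shows "deg (cls u) u > 0"
proof -
  have "Max (keys u) \<in> keys u" using assms by (intro Max_in) auto
  then show ?thesis using assms by (simp add: cls_def in_keys_iff)
qed

lemma cls_ge_1: "u \<in> mons n \<Longrightarrow> 1 \<le> cls u"
  using deg_cls[of u] unfolding mons_iff
  by (metis atLeastAtMost_iff cls_def less_irrefl less_one not_le_imp_less order_refl)

lemma cls_in_range: "u \<noteq> 0 \<Longrightarrow> u \<in> mons n \<Longrightarrow> cls u \<in> {1..n}"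
  using deg_cls[of u] unfolding mons_iff by fastforce

lemma P_mult_subset: "u \<in> mons n \<Longrightarrow> P_mult n u \<subseteq> {1..n}"
  using cls_ge_1[of u n] by (auto simp: P_mult_def)

text \<open>Here \<open>x\<^sub>1\<close> is the largest variable. This order, unrelated to \<open>lt\<close>, witnesses the continuity of both
  divisions: the involutive divisor of a nonmultiplicative prolongation of \<open>u\<close> is lexicographically
  greater than \<open>u\<close>, so chains of such divisors inside a finite set end.\<close>

definition lex_greater :: "mono \<Rightarrow> mono \<Rightarrow> bool" where
  "lex_greater v u \<longleftrightarrow> (\<exists>i. deg i u < deg i v \<and> (\<forall>j<i. deg j v = deg j u))"

lemma wf_lex_greater:
  assumes "finite U"
  shows "wf {(v, u). v \<in> U \<and> u \<in> U \<and> lex_greater v u}" (is "wf ?R")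
proof (rule finite_acyclic_wf)
  show "finite ?R" by (rule finite_subset[of _ "U \<times> U"]) (use assms in auto)
  have "trans ?R"
  proof (rule transI, clarsimp)
    fix u v w assume "lex_greater u v" "lex_greater v w"
    then obtain i k where i: "deg i v < deg i u" "\<And>j. j < i \<Longrightarrow> deg j u = deg j v"
      and k: "deg k w < deg k v" "\<And>j. j < k \<Longrightarrow> deg j v = deg j w"
      unfolding lex_greater_def by blast
    show "lex_greater u w"
      unfolding lex_greater_def using i k
      by (intro exI[of _ "min i k"]) (cases i k rule: linorder_cases, auto simp: min_def)
  qed
  then have "?R\<^sup>+ = ?R" by (rule trancl_id)
  then show "acyclic ?R" by (auto simp: acyclic_def lex_greater_def)
qed

section \<open>Janet division\<close>

lemma J_mult_iff:
  assumes "finite U" "u \<in> U"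
  shows "i \<in> J_mult n U u \<longleftrightarrow>
    i \<in> {1..n} \<and> (\<forall>v\<in>U. (\<forall>j\<in>{1..<i}. deg j v = deg j u) \<longrightarrow> deg i v \<le> deg i u)"
proof -
  define S where "S = {deg i v | v. v \<in> U \<and> (\<forall>j\<in>{1..<i}. deg j v = deg j u)}"
  have "finite S" unfolding S_def using assms(1) by auto
  moreover have "deg i u \<in> S" using assms(2) by (auto simp: S_def)
  ultimately have "deg i u = Max S \<longleftrightarrow> (\<forall>s\<in>S. s \<le> deg i u)"
    by (metis Max_eqI Max_ge)
  then show ?thesis unfolding J_mult_def S_def by blast
qed

text \<open>At the first index \<open>i\<close> where \<open>u\<close> and \<open>v\<close> differ,
  the one with the smaller exponent needs \<open>x_i\<close> to reach \<open>w\<close>, so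
  \<open>x_i\<close> is multiplicative for it. But the other one belongs to the same group and has a
  larger exponent there.\<close>

lemma J_cones_disjoint:
  assumes "finite U" "u \<in> U" "v \<in> U" "inv_divides (J_mult n U) u w" "inv_divides (J_mult n U) v w"
  shows "u = v"
proof (rule ccontr)
  have *: False if "u \<in> U" "v \<in> U" "inv_divides (J_mult n U) u w" "inv_divides (J_mult n U) v w"
    "deg i u < deg i v" "\<And>j. j < i \<Longrightarrow> deg j u = deg j v" for u v i
  proof -
    have "deg i u < deg i w" using that by (meson inv_divides_iff order_less_le_trans)
    then have "i \<in> J_mult n U u" using that(3) by (simp add: inv_divides_iff)
    then show False using J_mult_iff[OF assms(1) that(1)] that(2,5,6) by fastforce
  qed
  assume "u \<noteq> v"
  then obtain i where "deg i u \<noteq> deg i v" "\<And>j. j < i \<Longrightarrow> deg j u = deg j v"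
    by (rule mono_first_difference) blast
  then show False using *[of u v i] *[of v u i] assms(2-5) by fastforce
qed

text \<open>If \<open>v\<close> were smaller than \<open>u\<close> at the first index where they
  differ, that variable would be multiplicative for \<open>v\<close>, although \<open>u\<close> lies
  in the same group with a larger exponent.\<close>

lemma J_continuous:
  assumes "finite U" "u \<in> U" "v \<in> U" "i \<notin> J_mult n U u" "inv_divides (J_mult n U) v (u + var i)"
  shows "lex_greater v u"
proof -
  have "v \<noteq> u" using assms(4,5) by (auto simp: inv_divides_iff lookup_add deg_var split: if_splits)
  then obtain j where j: "deg j v \<noteq> deg j u" "\<And>k. k < j \<Longrightarrow> deg k v = deg k u"
    by (rule mono_first_difference) blast
  have "\<not> deg j v < deg j u"
  proof
    assume "deg j v < deg j u"
    then have "deg j v < deg j (u + var i)" by (simp add: lookup_add)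
    then have "j \<in> J_mult n U v" using assms(5) by (simp add: inv_divides_iff)
    then have "deg j u \<le> deg j v" using J_mult_iff[OF assms(1,3)] assms(2) j(2) by simp
    then show False using \<open>deg j v < deg j u\<close> by simp
  qed
  then show ?thesis using j unfolding lex_greater_def by (intro exI[of _ j]) auto
qed

section \<open>Pommaret division\<close>

definition P_reduced :: "nat \<Rightarrow> mono set \<Rightarrow> bool" where
  "P_reduced n U \<longleftrightarrow> U \<subseteq> mons n \<and> (\<forall>u\<in>U. \<forall>v\<in>U. inv_divides (P_mult n) u v \<longrightarrow> u = v)"

text \<open>Past the class, \<open>u\<close> has exponent 0 and all variables are multiplicative, so
  only the exponents up to the class matter.\<close>

lemma P_divides_of_le:
  assumes "u \<in> mons n" "v \<in> mons n" "deg (cls u) u \<le> deg (cls u) v" "\<And>j. j < cls u \<Longrightarrow> deg j u = deg j v"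
  shows "inv_divides (P_mult n) u v"
  unfolding inv_divides_iff
proof (intro conjI allI impI)
  fix j
  show "deg j u \<le> deg j v"
    using assms(3,4) deg_gt_cls[of u j] by (cases j "cls u" rule: linorder_cases) auto
  assume "deg j u < deg j v"
  then have "cls u \<le> j" "j \<in> {1..n}"
    using assms(4)[of j] assms(2) unfolding mons_iff by fastforce+
  then show "j \<in> P_mult n u" by (simp add: P_mult_def)
qed

lemma P_divides_low: "inv_divides (P_mult n) u w \<Longrightarrow> j < cls u \<Longrightarrow> deg j u = deg j w"
  unfolding inv_divides_iff P_mult_def by (metis atLeastAtMost_iff le_neq_implies_less not_le)

text \<open>Two Pommaret divisors of \<open>w\<close> agree with \<open>w\<close> below their
  classes. Hence the one of smaller class, or of smaller exponent at a common class, is a Pommaret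
  divisor of the other.\<close>

lemma P_cones_disjoint:
  assumes "P_reduced n U" "u \<in> U" "v \<in> U" "inv_divides (P_mult n) u w" "inv_divides (P_mult n) v w"
  shows "u = v"
proof -
  have *: "inv_divides (P_mult n) u v" if "u \<in> U" "v \<in> U" "inv_divides (P_mult n) u w" "inv_divides (P_mult n) v w"
     "cls u < cls v \<or> cls u = cls v \<and> deg (cls u) u \<le> deg (cls u) v" for u v
  proof (rule P_divides_of_le)
    show "deg (cls u) u \<le> deg (cls u) v"
      using that(5)
    proof
      assume "cls u < cls v"
      then show ?thesis using P_divides_low[OF that(4)] that(3) by (simp add: inv_divides_iff)
    qed auto
    show "deg j u = deg j v" if "j < cls u" for j
      using that \<open>cls u < cls v \<or> _\<close> P_divides_low[OF \<open>inv_divides (P_mult n) u w\<close>, of j]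
        P_divides_low[OF \<open>inv_divides (P_mult n) v w\<close>, of j] by auto
  qed (use assms(1) that in \<open>auto simp: P_reduced_def\<close>)
  have "inv_divides (P_mult n) u v \<or> inv_divides (P_mult n) v u"
    using *[of u v] *[of v u] assms(2-5) linear[of "deg (cls v) u" "deg (cls v) v"]
    by (cases "cls u" "cls v" rule: linorder_cases) auto
  then show ?thesis using assms(1-3) unfolding P_reduced_def by blast
qed

text \<open>The divisor \<open>v\<close> must absorb the new factor \<open>x_i\<close>, for
  otherwise it would be a Pommaret divisor of \<open>u\<close> itself. As \<open>i <= cls v\<close>,
  it agrees with \<open>u\<close> before \<open>i\<close> and exceeds it at
  \<open>i\<close>.\<close>

lemma P_continuous:
  assumes "P_reduced n U" "u \<in> U" "v \<in> U" "i \<in> {1..n}" "i \<notin> P_mult n u" "inv_divides (P_mult n) v (u + var i)"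
  shows "lex_greater v u"
proof -
  have i: "i < cls u" using assms(4,5) by (auto simp: P_mult_def)
  have low: "deg j v = deg j (u + var i)" if "j < cls v" for j
    using P_divides_low[OF assms(6) that] .
  have le: "deg j v \<le> deg j (u + var i)" for j using assms(6) by (simp add: inv_divides_iff)
  have not_dvd: "\<not> (cls v \<le> i \<and> deg (cls v) v \<le> deg (cls v) u)"
  proof
    assume *: "cls v \<le> i \<and> deg (cls v) v \<le> deg (cls v) u"
    have "inv_divides (P_mult n) v u"
      using assms(1-3) * low by (intro P_divides_of_le) (auto simp: P_reduced_def lookup_add deg_var)
    then have "v = u" using assms(1-3) unfolding P_reduced_def by blast
    then show False using * i by simp
  qed
  have "deg i u < deg i v \<and> i \<le> cls v"
  proof (cases "i < cls v")
    case True
    then show ?thesis using low[of i] by (simp add: lookup_add deg_var)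
  next
    case False
    then have "deg (cls v) u < deg (cls v) v" using not_dvd by auto
    moreover from this have "cls v = i"
      using le[of "cls v"] by (auto simp: lookup_add deg_var split: if_splits)
    ultimately show ?thesis by auto
  qed
  then show ?thesis
    unfolding lex_greater_def using low by (intro exI[of _ i]) (auto simp: lookup_add deg_var)
qed

section \<open>The Pommaret generators of a monomial ideal\<close>

text \<open>Every divisor of a generator inside \<open>M\<close> carries the full power of its last
  variable; otherwise it would still divide the generator with that variable stripped once, which
  lies outside \<open>M\<close>. Most later contradictions end here.\<close>

lemma pom_gens_strip:
  assumes "mono_ideal n M" "u \<in> pom_gens M" "v \<in> M" "\<And>j. deg j v \<le> deg j u"
    "deg (cls u) v < deg (cls u) u"
  shows False
proof -
  have "u \<in> mons n" "u \<noteq> 0" using assms by (auto simp: pom_gens_def mono_ideal_def)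
  obtain w where w: "u = var (cls u) + w" "\<And>j. deg j w = deg j u - (if j = cls u then 1 else 0)"
    using mono_split_var[of u "cls u"] deg_cls[OF \<open>u \<noteq> 0\<close>] by blast
  have "w \<in> M"
  proof (rule mono_ideal_dvd[OF assms(1,3)])
    show "w \<in> mons n" using w(1) \<open>u \<in> mons n\<close> by (metis mons_add_iff)
    show "deg j v \<le> deg j w" for j using w(2)[of j] assms(4)[of j] assms(5) by auto
  qed
  then show False using assms(2) w(1) \<open>u \<noteq> 0\<close> by (auto simp: pom_gens_def)
qed

text \<open>By \<open>pom_gens_strip\<close> a divisor \<open>v\<close> has the full exponent at
  \<open>cls u\<close>, hence \<open>cls u <= cls v\<close>. A nontrivial multiplicative quotient
  could then only be a power of the last variable of \<open>u\<close>, whose exponent is already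
  exhausted.\<close>

lemma pom_gens_P_divisor:
  assumes "mono_ideal n M" "u \<in> pom_gens M" "v \<in> M" "inv_divides (P_mult n) v u"
  shows "v = u"
proof (rule ccontr)
  assume "v \<noteq> u"
  have le: "\<And>j. deg j v \<le> deg j u" using assms(4) by (simp add: inv_divides_iff)
  have "deg (cls u) v < deg (cls u) u"
  proof (rule ccontr)
    assume nl: "\<not> ?thesis"
    then have "deg (cls u) v = deg (cls u) u" using le[of "cls u"] by simp
    obtain j where j: "deg j v < deg j u"
      using \<open>v \<noteq> u\<close> mono_eqI[of v u] le by (meson order.order_iff_strict)
    then have "u \<noteq> 0" "j \<in> P_mult n v" using assms(4) by (auto simp: inv_divides_iff)
    then have "cls v \<le> j" by (simp add: P_mult_def)
    moreover have "j \<le> cls u" using deg_gt_cls[of u j] j by (cases "j \<le> cls u") auto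
    moreover have "cls u \<le> cls v"
      using deg_cls[OF \<open>u \<noteq> 0\<close>] \<open>deg (cls u) v = _\<close> deg_gt_cls[of v "cls u"] by (cases "cls u \<le> cls v") auto
    ultimately have "j = cls u" by simp
    then show False using j nl by simp
  qed
  then show False using pom_gens_strip[OF assms(1-3) le] by blast
qed

lemma pom_gens_subset: "pom_gens M \<subseteq> M"
  by (auto simp: pom_gens_def)

lemma P_reduced_pom_gens: "mono_ideal n M \<Longrightarrow> P_reduced n (pom_gens M)"
  using pom_gens_P_divisor pom_gens_subset unfolding P_reduced_def mono_ideal_def by blast

context monomial_order
begin

text \<open>Strip the last variable until a generator divides. The divisor \<open>g\<close> found
  for the stripped monomial has class at most \<open>cls u\<close>, so the stripped variable is
  multiplicative for \<open>g\<close>. For \<open>g = 0\<close> this relies on the convention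
  \<open>cls 0 = 1\<close>.\<close>

lemma pom_gens_complete:
  assumes "mono_ideal n M"
  shows "inv_complete (P_mult n) M (pom_gens M)"
  unfolding inv_complete_def
proof
  fix u assume "u \<in> M"
  then show "\<exists>g\<in>pom_gens M. inv_divides (P_mult n) g u"
  proof (induction u rule: wf_induct_rule[OF wf_lt])
    case (1 u)
    show ?case
    proof (cases "u \<in> pom_gens M")
      case False
      then obtain v where v: "u = var (cls u) + v" "v \<in> M" "u \<noteq> 0"
        using 1(2) by (auto simp: pom_gens_def)
      have u: "u \<in> mons n" and vm: "v \<in> mons n" using assms 1(2) v(2) by (auto simp: mono_ideal_def)
      have "var (cls u) \<noteq> 0" using deg_var[of "cls u" "cls u"] by auto
      then have "lt v u"
        using lt_multiple[of "var (cls u)" v] vm v(1) cls_in_range[OF v(3) u] by (metis add.commute var_in_mons)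
      then obtain g where g: "g \<in> pom_gens M" "inv_divides (P_mult n) g v"
        using 1(1)[of v] u vm v(2) by auto
      have "cls g \<le> cls u"
      proof (cases "g = 0")
        case True
        then show ?thesis using cls_ge_1[OF u] by (simp add: cls_def)
      next
        case False
        then have "deg (cls g) v > 0"
          using deg_cls[of g] g(2) unfolding inv_divides_iff by (meson order_less_le_trans)
        then have "deg (cls g) u > 0" using v(1) by (metis lookup_add add_gr_0)
        then show ?thesis using deg_gt_cls[of u "cls g"] by (cases "cls g \<le> cls u") auto
      qed
      then have "inv_divides (P_mult n) g u"
        using g(2) cls_in_range[OF v(3) u] lookup_add[of "var (cls u)" v, folded v(1)]
        unfolding inv_divides_iff P_mult_def
        by (auto simp: deg_var intro: le_trans)
      then show ?thesis using g(1) by blast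
    qed (auto intro: bexI[of _ u])
  qed
qed

text \<open>A generator is its own only Pommaret divisor in \<open>M\<close>, so a complete
  \<open>U\<close> contains it. Conversely each \<open>u\<close> in \<open>U\<close> has a generator
  as Pommaret divisor, and reducedness of \<open>U\<close> identifies the two.\<close>

lemma P_basis_unique:
  assumes "mono_ideal n M" "U \<subseteq> M" "P_reduced n U" "inv_complete (P_mult n) M U"
  shows "U = pom_gens M"
proof -
  have "pom_gens M \<subseteq> U"
    using assms pom_gens_P_divisor[OF assms(1)] pom_gens_subset unfolding inv_complete_def by blast
  moreover have "u \<in> pom_gens M" if "u \<in> U" for u
    using that pom_gens_complete[OF assms(1)] \<open>pom_gens M \<subseteq> U\<close> assms(2,3)
    unfolding inv_complete_def P_reduced_def by blast
  ultimately show ?thesis by blast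
qed

text \<open>If \<open>v\<close> agreed with \<open>u\<close> before some \<open>i >= cls u\<close>
  and exceeded it at \<open>i\<close>, then \<open>u\<close> would be a Pommaret divisor of the
  generator \<open>v\<close>.\<close>

lemma P_mult_subset_J_mult:
  assumes "mono_ideal n M" "finite (pom_gens M)" "u \<in> pom_gens M"
  shows "P_mult n u \<subseteq> J_mult n (pom_gens M) u"
proof
  fix i assume i: "i \<in> P_mult n u"
  have mons: "pom_gens M \<subseteq> mons n" using assms(1) pom_gens_subset by (auto simp: mono_ideal_def)
  show "i \<in> J_mult n (pom_gens M) u"
    unfolding J_mult_iff[OF assms(2,3)]
  proof (intro conjI ballI impI)
    show "i \<in> {1..n}" using i P_mult_subset mons assms(3) by blast
    fix v assume v: "v \<in> pom_gens M" and eq: "\<forall>j\<in>{1..<i}. deg j v = deg j u"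
    have eq': "deg j u = deg j v" if "j < i" for j
      using eq that mons assms(3) v by (cases "j = 0") (auto simp: mons_iff subset_iff)
    show "deg i v \<le> deg i u"
    proof (rule ccontr)
      assume "\<not> deg i v \<le> deg i u"
      then have "inv_divides (P_mult n) u v"
        using i eq' mons assms(3) v by (intro P_divides_of_le) (auto simp: P_mult_def le_less)
      then have "u = v" using P_reduced_pom_gens[OF assms(1)] assms(3) v unfolding P_reduced_def by blast
      then show False using \<open>\<not> deg i v \<le> deg i u\<close> by simp
    qed
  qed
qed

lemma pom_gens_J_complete:
  assumes "mono_ideal n M" "finite (pom_gens M)"
  shows "inv_complete (J_mult n (pom_gens M)) M (pom_gens M)"
  using pom_gens_complete[OF assms(1)] P_mult_subset_J_mult[OF assms]
  unfolding inv_complete_def inv_divides_def by blast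

text \<open>The essential use of finiteness: for large \<open>N\<close> the Pommaret
  divisor of \<open>u\<close> times \<open>x\<^sub>i\<close> to the \<open>N\<close> cannot involve the full power of \<open>x\<^sub>i\<close>, hence no later variable.\<close>

lemma pom_gens_finite_prefix:
  assumes "mono_ideal n M" "finite (pom_gens M)" "u \<in> M" "i \<in> {1..n}"
  obtains t where "t \<in> M" "\<And>j. j < i \<Longrightarrow> deg j t = deg j u" "\<And>j. i < j \<Longrightarrow> deg j t = 0"
proof -
  obtain N where N: "\<And>g. g \<in> pom_gens M \<Longrightarrow> deg i g < N"
    using finite_nat_set_iff_bounded[of "deg i ` pom_gens M"] assms(2) by auto
  define w where "w = u + single i N"
  have u: "u \<in> mons n" using assms(1,3) by (auto simp: mono_ideal_def)
  have deg_w: "deg j w = deg j u + (if j = i then N else 0)" for j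
    by (simp add: w_def lookup_add lookup_single when_def)
  have "w \<in> mons n" using u assms(4) by (simp add: mons_iff deg_w)
  then have "w \<in> M" using mono_ideal_dvd[OF assms(1,3)] deg_w by simp
  then obtain g where g: "g \<in> pom_gens M" "inv_divides (P_mult n) g w"
    using pom_gens_complete[OF assms(1)] by (auto simp: inv_complete_def)
  have "deg i g < deg i w" using N[OF g(1)] by (simp add: deg_w)
  then have "cls g \<le> i" using g(2) by (auto simp: inv_divides_iff P_mult_def)
  obtain t where t: "\<And>j. deg j t = (if j \<le> i then deg j w else 0)" using mono_truncate[of i w] by blast
  have "t \<in> M"
  proof (rule mono_ideal_dvd[OF assms(1)])
    show "g \<in> M" using g(1) by (simp add: pom_gens_def)
    show "t \<in> mons n" using \<open>w \<in> mons n\<close> by (simp add: mons_iff t)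
    show "deg j g \<le> deg j t" for j
      using g(2) deg_gt_cls[of g j] \<open>cls g \<le> i\<close> by (auto simp: t inv_divides_iff)
  qed
  then show ?thesis using that[of t] t deg_w by simp
qed

text \<open>Let \<open>v\<close> be the Janet divisor of the generator \<open>u\<close>. If
  \<open>v\<close> differs from \<open>u\<close>, it does so at some \<open>i < cls u\<close>, and
  \<open>x_i\<close> is multiplicative for \<open>v\<close>. Take \<open>t\<close> in
  \<open>M\<close> with the exponents of \<open>v\<close> before \<open>i\<close> and none after
  \<open>i\<close>, and its Janet divisor \<open>x\<close>. Maximality in the Janet groups makes
  \<open>x\<close> agree with \<open>v\<close> before \<open>i\<close> and bounds it by
  \<open>v\<close> at \<open>i\<close>. So \<open>x\<close> divides \<open>u\<close> but lacks the
  last variable of \<open>u\<close>, against \<open>pom_gens_strip\<close>.\<close>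

lemma pom_gens_subset_J_complete:
  assumes "mono_ideal n M" "finite (pom_gens M)" "finite V" "V \<subseteq> M" "inv_complete (J_mult n V) M V"
  shows "pom_gens M \<subseteq> V"
proof
  fix u assume u: "u \<in> pom_gens M"
  then obtain v where v: "v \<in> V" "inv_divides (J_mult n V) v u"
    using assms(5) pom_gens_subset unfolding inv_complete_def by blast
  have le: "\<And>j. deg j v \<le> deg j u" using v(2) by (simp add: inv_divides_iff)
  have "v = u"
  proof (rule ccontr)
    assume "v \<noteq> u"
    then obtain i where i: "deg i v < deg i u"
      using mono_eqI[of v u] le by (meson order.order_iff_strict)
    then have "u \<noteq> 0" by auto
    have k: "deg (cls u) v = deg (cls u) u"
      using pom_gens_strip[OF assms(1) u _ le] v(1) assms(4) le by (meson order.order_iff_strict subset_iff)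
    then have "i < cls u" using deg_gt_cls[of u i] i by (cases i "cls u" rule: linorder_cases) auto
    have iJ: "i \<in> J_mult n V v" using v(2) i by (simp add: inv_divides_iff)
    then have "i \<in> {1..n}" by (simp add: J_mult_def)
    then obtain t where t: "t \<in> M" "\<And>j. j < i \<Longrightarrow> deg j t = deg j v" "\<And>j. i < j \<Longrightarrow> deg j t = 0"
      using pom_gens_finite_prefix[OF assms(1,2)] v(1) assms(4) by blast
    then obtain x where x: "x \<in> V" "inv_divides (J_mult n V) x t"
      using assms(5) unfolding inv_complete_def by blast
    have xt: "deg j x \<le> deg j t" for j using x(2) by (simp add: inv_divides_iff)
    have prefix: "deg j x = deg j v" if "j < i" for j
      using that
    proof (induction j rule: less_induct)
      case (less j)
      show ?case
      proof (rule ccontr)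
        assume "deg j x \<noteq> deg j v"
        then have "deg j x < deg j t" using xt[of j] t(2)[OF less.prems] by simp
        then have "j \<in> J_mult n V x" using x(2) by (simp add: inv_divides_iff)
        then have "deg j v \<le> deg j x" using J_mult_iff[OF assms(3) x(1)] v(1) less by fastforce
        then show False using \<open>deg j x < deg j t\<close> t(2)[OF less.prems] by simp
      qed
    qed
    have "deg i x \<le> deg i v" using iJ J_mult_iff[OF assms(3) v(1)] x(1) prefix by simp
    then have "deg j x \<le> deg j v" for j
      using prefix[of j] xt[of j] t(3)[of j] by (cases i j rule: linorder_cases) auto
    then have "deg j x \<le> deg j u" for j using le le_trans by blast
    moreover have "deg (cls u) x < deg (cls u) u"
      using xt[of "cls u"] t(3)[OF \<open>i < cls u\<close>] deg_cls[OF \<open>u \<noteq> 0\<close>] by simp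
    ultimately show False using pom_gens_strip[OF assms(1) u] x(1) assms(4) by blast
  qed
  then show "u \<in> V" using v(1) by simp
qed

text \<open>Deleting \<open>u\<close> enlarges the Janet cones of the remaining monomials; they still avoid \<open>u\<close>, so Janet
  autoreduction does not change a set with these leading monomials.\<close>

lemma pom_gens_J_irreducible:
  assumes "mono_ideal n M" "finite (pom_gens M)" "u \<in> pom_gens M" "v \<in> pom_gens M - {u}"
  shows "\<not> inv_divides (J_mult n (pom_gens M - {u})) v u"
proof
  assume v: "inv_divides (J_mult n (pom_gens M - {u})) v u"
  have vM: "v \<in> M" using assms(4) pom_gens_subset by blast
  have le: "\<And>j. deg j v \<le> deg j u" using v by (simp add: inv_divides_iff)
  obtain i where i: "deg i v < deg i u"
    using mono_eqI[of v u] le assms(4) by (metis DiffD2 insertI1 order.order_iff_strict)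
  then have "u \<noteq> 0" by auto
  have k: "deg (cls u) v = deg (cls u) u"
    using pom_gens_strip[OF assms(1,3) vM le] le by (meson order.order_iff_strict)
  then have "i < cls u" using deg_gt_cls[of u i] i by (cases i "cls u" rule: linorder_cases) auto
  have iJ: "i \<in> J_mult n (pom_gens M - {u}) v" using v i by (simp add: inv_divides_iff)
  then have "i \<in> {1..n}" by (simp add: J_mult_def)
  then obtain t where t: "t \<in> M" "\<And>j. j < i \<Longrightarrow> deg j t = deg j v" "\<And>j. i < j \<Longrightarrow> deg j t = 0"
    using pom_gens_finite_prefix[OF assms(1,2) vM] by blast
  then obtain g where g: "g \<in> pom_gens M" "inv_divides (P_mult n) g t"
    using pom_gens_complete[OF assms(1)] unfolding inv_complete_def by blast
  have gt: "deg j g \<le> deg j t" for j using g(2) by (simp add: inv_divides_iff)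
  \<comment> \<open>The argument of \<open>pom_gens_subset_J_complete\<close> is repeated with the
    Pommaret divisor \<open>g\<close> of \<open>t\<close>. The smaller exponent at
    \<open>cls u\<close> shows that \<open>g\<close> is not the deleted \<open>u\<close>, so it may
    be compared with \<open>v\<close> in the Janet groups of the remaining set.\<close>
  have gk: "deg (cls u) g < deg (cls u) u"
    using gt[of "cls u"] t(3)[OF \<open>i < cls u\<close>] deg_cls[OF \<open>u \<noteq> 0\<close>] by simp
  have "deg i g \<le> deg i v"
  proof (cases "\<forall>j<i. deg j g = deg j v")
    case True
    have "g \<in> pom_gens M - {u}" using g(1) gk by auto
    then show ?thesis using iJ J_mult_iff[OF _ assms(4)] assms(2) True by simp
  next
    case False
    then obtain j where j: "j < i" "deg j g < deg j t"
      using gt t(2) by (metis order.order_iff_strict)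
    then have "cls g \<le> j" using g(2) by (auto simp: inv_divides_iff P_mult_def)
    then show ?thesis using deg_gt_cls[of g i] j(1) by simp
  qed
  then have "deg j g \<le> deg j v" for j
    using gt[of j] t(2)[of j] t(3)[of j] by (cases i j rule: linorder_cases) auto
  then have "deg j g \<le> deg j u" for j using le le_trans by blast
  then show False using pom_gens_strip[OF assms(1,3) _ _ gk] g(1) pom_gens_subset by blast
qed

section \<open>Finite Janet complete sets\<close>

lemma dickson_basis:
  assumes "A \<subseteq> mons n"
  obtains B where "finite B" "B \<subseteq> A" "\<And>a. a \<in> A \<Longrightarrow> \<exists>b\<in>B. \<forall>i. deg i b \<le> deg i a"
proof
  define B where "B = {b \<in> A. \<forall>b'\<in>A. \<forall>v. b = b' + v \<longrightarrow> v = 0}"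
  show "B \<subseteq> A" by (auto simp: B_def)
  show "finite B"
  proof (rule ccontr)
    assume "infinite B"
    then obtain s :: "nat \<Rightarrow> mono" where s: "inj s" "range s \<subseteq> B"
      using infinite_countable_subset by blast
    then have sB: "s i \<in> B" for i by auto
    then obtain i j v where ij: "i < j" "s j = s i + v"
      using dickson_comparable_pair[of s] assms by (metis (no_types, lifting) B_def mem_Collect_eq subsetD)
    then have "v = 0" using sB[of i] sB[of j] by (auto simp: B_def)
    then show False using ij s(1) by (auto simp: inj_def)
  qed
  show "\<exists>b\<in>B. \<forall>i. deg i b \<le> deg i a" if "a \<in> A" for a
    using that
  proof (induction a rule: wf_induct_rule[OF wf_lt])
    case (1 a)
    show ?case
    proof (cases "a \<in> B")
      case False
      then obtain b v where b: "b \<in> A" "a = b + v" "v \<noteq> 0" using 1(2) by (auto simp: B_def)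
      then have "b \<in> mons n" "a \<in> mons n" "v \<in> mons n" using assms 1(2) by auto
      then have "lt b a" using b lt_multiple by simp
      then obtain c where "c \<in> B" "\<forall>i. deg i c \<le> deg i b"
        using 1(1)[of b] b(1) \<open>b \<in> mons n\<close> \<open>a \<in> mons n\<close> by auto
      then show ?thesis using b(2) by (auto simp: lookup_add intro!: bexI[of _ c] trans_le_add1)
    qed auto
  qed
qed

lemma finite_J_complete_exists:
  assumes "mono_ideal n M"
  obtains U where "finite U" "U \<subseteq> M" "inv_complete (J_mult n U) M U"
proof -
  have M: "M \<subseteq> mons n" using assms by (simp add: mono_ideal_def)
  then obtain B where B: "finite B" "B \<subseteq> M" "\<And>a. a \<in> M \<Longrightarrow> \<exists>b\<in>B. \<forall>i. deg i b \<le> deg i a"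
    using dickson_basis by blast
  \<comment> \<open>The bound \<open>D\<close> covers all exponents of a Dickson basis, so capping
    exponents at \<open>D\<close> never leaves \<open>M\<close>.\<close>
  have "finite (\<Union>b\<in>B. (\<lambda>i. deg i b) ` {1..n})" using B(1) by simp
  then obtain D where "\<forall>d\<in>(\<Union>b\<in>B. (\<lambda>i. deg i b) ` {1..n}). d \<le> D"
    using finite_nat_set_iff_bounded_le by blast
  then have D: "deg i b \<le> D" if "b \<in> B" for i b
    using that M B(2) by (cases "i \<in> {1..n}") (auto simp: mons_iff subset_iff)
  \<comment> \<open>Capping the exponents of \<open>w\<close> at \<open>D\<close> yields its Janet divisor: the capped variables have maximal degree.\<close>
  define U where "U = {u \<in> M. \<forall>i. deg i u \<le> D}"
  have "finite U"
  proof (rule finite_imageD)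
    have "lookup ` U \<subseteq> {f. \<forall>x. (x \<in> {1..n} \<longrightarrow> f x \<in> {..D}) \<and> (x \<notin> {1..n} \<longrightarrow> f x = 0)}"
      using M by (auto simp: U_def mons_iff subset_iff)
    then show "finite (lookup ` U)"
      using finite_set_of_finite_funs[of "{1..n}" "{..D}" 0] finite_subset by blast
    show "inj_on lookup U" by (auto intro!: inj_onI poly_mapping_eqI)
  qed
  moreover have "inv_complete (J_mult n U) M U"
    unfolding inv_complete_def
  proof
    fix w assume w: "w \<in> M"
    have "finite {i. min (deg i w) D \<noteq> 0}"
      by (rule finite_subset[of _ "keys w"]) (auto simp: in_keys_iff)
    then obtain u where u: "\<And>i. deg i u = min (deg i w) D"
      using lookup_Abs_poly_mapping[of "\<lambda>i. min (deg i w) D"] by (metis (no_types, lifting))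
    obtain b where b: "b \<in> B" "\<forall>i. deg i b \<le> deg i w" using B(3)[OF w] by blast
    have "u \<in> M"
    proof (rule mono_ideal_dvd[OF assms])
      show "b \<in> M" using b B(2) by blast
      show "u \<in> mons n" using w M u by (auto simp: mons_iff subset_iff)
      show "deg i b \<le> deg i u" for i using b D u by simp
    qed
    then have "u \<in> U" using u by (simp add: U_def)
    moreover have "inv_divides (J_mult n U) u w"
      unfolding inv_divides_iff J_mult_iff[OF \<open>finite U\<close> \<open>u \<in> U\<close>]
    proof (intro conjI allI impI ballI)
      fix i assume i: "deg i u < deg i w"
      then show "i \<in> {1..n}" using w M by (cases "i \<in> {1..n}") (auto simp: mons_iff subset_iff)
      show "deg i v \<le> deg i u" if "v \<in> U" for v
        using that i by (auto simp: U_def u)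
    qed (simp add: u)
    ultimately show "\<exists>u\<in>U. inv_divides (J_mult n U) u w" by blast
  qed
  ultimately show ?thesis using that[of U] by (auto simp: U_def)
qed

end

section \<open>Janet and Pommaret bases\<close>

context monomial_order
begin

definition lead :: "('a::zero) mpoly set \<Rightarrow> mono set" where
  "lead I = lm lt ` (I - {0})"

lemma ideal_polys: "is_ideal n I \<Longrightarrow> I \<subseteq> polys n"
  by (simp add: is_ideal_def)

lemma mono_ideal_lead:
  fixes I :: "('a::field) mpoly set"
  assumes "is_ideal n I"
  shows "mono_ideal n (lead I)"
  unfolding mono_ideal_def
proof (intro conjI ballI subsetI)
  fix u assume "u \<in> lead I"
  then obtain f where f: "f \<in> I" "f \<noteq> 0" "u = lm lt f" by (auto simp: lead_def)
  then have fp: "f \<in> polys n" using ideal_polys[OF assms] by blast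
  then show "u \<in> mons n" using f lm_in_mons by blast
  fix v assume v: "v \<in> mons n"
  have "single v 1 * f \<in> I"
    using assms f(1) polys_single[OF v, of "1 :: 'a"] unfolding is_ideal_def by blast
  moreover have "lm lt (single v 1 * f) = u + v"
    using lm_single_mult[OF fp f(2) v, of 1] f(3) by (simp add: add.commute)
  moreover have "single v 1 * f \<noteq> 0"
    using lookup_single_mult[of v 1 f "lm lt f"] lc_nonzero[OF fp f(2)] by (auto simp: lc_def)
  ultimately show "u + v \<in> lead I" by (force simp: lead_def)
qed

lemma lm_image_subset_lead: "F \<subseteq> I \<Longrightarrow> 0 \<notin> F \<Longrightarrow> lm lt ` F \<subseteq> lead I"
  by (auto simp: lead_def)

lemma inv_complete_lead_iff:
  "inv_complete m (lead I) (lm lt ` F) \<longleftrightarrow>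
     (\<forall>p\<in>I. p \<noteq> 0 \<longrightarrow> (\<exists>f\<in>F. inv_divides m (lm lt f) (lm lt p)))"
  by (auto simp: inv_complete_def lead_def)

text \<open>The leading term is set aside and the tail is reduced modulo all nonzero elements of
  \<open>I\<close>. The down-closed set of monomials strictly below \<open>u\<close> guarantees that
  \<open>u\<close> does not reappear.\<close>

lemma reduced_element_exists:
  fixes I :: "('a::field) mpoly set"
  assumes I: "is_ideal n I" and u: "u \<in> lead I"
  obtains f where "f \<in> I" "f \<noteq> 0" "lm lt f = u" "keys f \<inter> lead I = {u}"
proof -
  obtain p where p: "p \<in> I" "p \<noteq> 0" "u = lm lt p" using u by (auto simp: lead_def)
  have pp: "p \<in> polys n" using p(1) ideal_polys[OF I] by blast
  interpret inv_division n lt "\<lambda>_. {1..n}" "I - {0}"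
    by unfold_locales (use ideal_polys[OF I] in auto)
  define c where "c = lookup p u"
  have um: "u \<in> mons n" using lm_in_mons pp p by blast
  define q where "q = p - single u c"
  have q: "q \<in> polys n" using pp um by (simp add: q_def polys_diff polys_single)
  define B where "B = {v \<in> mons n. lt v u}"
  have "down_closed B" unfolding down_closed_def B_def using lt_trans um by blast
  have "keys q \<subseteq> B"
  proof
    fix v assume v: "v \<in> keys q"
    then have "v \<in> keys p" "v \<noteq> u"
      by (auto simp: q_def in_keys_iff lookup_minus lookup_single when_def c_def split: if_splits)
    then show "v \<in> B" using lm_max[OF pp p(2)] pp p(3) by (auto simp: B_def polys_iff)
  qed
  obtain r where r: "inv_NF (\<lambda>_. {1..n}) lt (I - {0}) q r" using inv_NF_exists[OF q] .
  then have rB: "keys r \<subseteq> B" and "q - r \<in> mpoly.span (prolongations UNIV)" and rp: "r \<in> polys n"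
    using inv_reds_span[of q r B] inv_reds_span[of q r UNIV] q \<open>keys q \<subseteq> B\<close> \<open>down_closed B\<close>
    by (auto simp: inv_NF_def down_closed_def)
  then have "q - r \<in> I" using span_subset_ideal[OF I] by blast
  then have f: "p - (q - r) \<in> I" using ideal_diff[OF I p(1)] by blast
  have eq: "p - (q - r) = single u c + r" by (simp add: q_def)
  have "u \<notin> B" using lt_irrefl um by (simp add: B_def)
  then have "lookup (p - (q - r)) u = c" using rB unfolding eq lookup_add
    by (auto simp: in_keys_iff subset_iff)
  moreover have "c \<noteq> 0" using lm_in_keys[OF pp p(2)] p(3) by (auto simp: c_def in_keys_iff)
  ultimately have uk: "u \<in> keys (p - (q - r))" by (simp add: in_keys_iff)
  have keys: "v \<in> keys r" if "v \<in> keys (p - (q - r))" "v \<noteq> u" for v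
    using that unfolding eq in_keys_iff lookup_add by (auto simp: lookup_single when_def)
  have irr: "v \<notin> lead I" if "v \<in> keys r" for v
  proof
    assume "v \<in> lead I"
    then obtain g where g: "g \<in> I - {0}" "v = lm lt g" by (auto simp: lead_def)
    then have "\<not> inv_divides (\<lambda>_. {1..n}) (lm lt g) v" using r that unfolding inv_NF_def by blast
    then show False using g(2) by simp
  qed
  show ?thesis
  proof (rule that[OF f])
    show "p - (q - r) \<noteq> 0" using uk by auto
    show "lm lt (p - (q - r)) = u"
      using keys rB uk f ideal_polys[OF I] by (intro lm_eqI) (auto simp: B_def)
    show "keys (p - (q - r)) \<inter> lead I = {u}" using uk u keys irr by blast
  qed
qed

text \<open>Janet bases turn out to be exactly the finite \<^term>\<open>tail_reduced\<close> sets whose leading monomials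
  are Janet complete; this replaces the reduction conditions in the definitions by conditions on
  monomials, and likewise for Pommaret bases.\<close>

definition tail_reduced :: "('a::field) mpoly set \<Rightarrow> 'a mpoly set \<Rightarrow> bool" where
  "tail_reduced I F \<longleftrightarrow> F \<subseteq> I \<and> 0 \<notin> F \<and> inj_on (lm lt) F \<and> (\<forall>f\<in>F. keys f \<inter> lead I = {lm lt f})"

end

context inv_division
begin

lemma disjoint_cones_imageI:
  assumes "inj_on (lm lt) F"
    and "\<And>u v w. u \<in> lm lt ` F \<Longrightarrow> v \<in> lm lt ` F \<Longrightarrow> inv_divides m u w \<Longrightarrow> inv_divides m v w \<Longrightarrow> u = v"
  shows disjoint_cones
  unfolding disjoint_cones_def
proof (intro ballI allI impI)
  fix f g w assume fg: "f \<in> F" "g \<in> F" "inv_divides m (lm lt f) w" "inv_divides m (lm lt g) w"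
  then have "lm lt f = lm lt g" using assms(2)[of "lm lt f" "lm lt g" w] by blast
  then show "f = g" using fg(1,2) assms(1) by (auto dest: inj_onD)
qed

lemma autoreduced_inj_on_lm:
  assumes "\<And>f g t. f \<in> F \<Longrightarrow> g \<in> F \<Longrightarrow> t \<in> keys f \<Longrightarrow> inv_divides m (lm lt g) t \<Longrightarrow> g = f"
  shows "inj_on (lm lt) F"
proof (rule inj_onI)
  fix f g assume fg: "f \<in> F" "g \<in> F" "lm lt f = lm lt g"
  have "lm lt g \<in> keys g" using lm_in_keys F_elemD(1,2) fg(2) by blast
  then show "f = g" using assms[of g f "lm lt g"] fg by simp
qed

text \<open>By completeness a term of \<open>f\<close> in \<open>lead I\<close> has an involutive
  divisor in the basis, which autoreducedness forces to be \<open>lm lt f\<close>. A term of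
  \<open>f\<close> that is a multiple of its leading monomial equals it.\<close>

lemma autoreduced_tail_reduced:
  assumes "F \<subseteq> I"
    and complete: "\<And>p. p \<in> I \<Longrightarrow> p \<noteq> 0 \<Longrightarrow> \<exists>f\<in>F. inv_divides m (lm lt f) (lm lt p)"
    and autoreduced: "\<And>f g t. f \<in> F \<Longrightarrow> g \<in> F \<Longrightarrow> t \<in> keys f \<Longrightarrow> inv_divides m (lm lt g) t \<Longrightarrow> g = f"
  shows "tail_reduced I F"
  unfolding tail_reduced_def
proof (intro conjI ballI)
  show "inj_on (lm lt) F" by (rule autoreduced_inj_on_lm[OF autoreduced])
  fix f assume f: "f \<in> F"
  note fD = F_elemD[OF f]
  have "t = lm lt f" if t: "t \<in> keys f" "t \<in> lead I" for t
  proof -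
    obtain g where g: "g \<in> F" "inv_divides m (lm lt g) t"
      using complete t(2) unfolding lead_def by auto
    then have "g = f" using autoreduced f t(1) by blast
    then obtain v where v: "t = lm lt f + v" "v \<in> mons n"
      using g multiplier_mons by (auto simp: inv_divides_def)
    show "t = lm lt f"
    proof (rule ccontr)
      assume "t \<noteq> lm lt f"
      then have "lt (lm lt f) t" "lt t (lm lt f)"
        using v fD lt_multiple lm_max[OF fD(1,2) t(1)] by auto
      then show False using lt_trans lt_irrefl v fD(3) by (metis mons_add_iff)
    qed
  qed
  moreover have "lm lt f \<in> lead I" using f fD(2) assms(1) unfolding lead_def by blast
  ultimately show "keys f \<inter> lead I = {lm lt f}" using lm_in_keys[OF fD(1,2)] by blast
qed (use assms(1) F_nonzero in auto)

text \<open>A term with a divisor in the basis lies in \<open>lead I\<close>, hence is the leading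
  monomial of \<open>f\<close>; disjoint cones leave \<open>f\<close> as the only divisor.\<close>

lemma tail_reduced_autoreduced:
  assumes "is_ideal n I" "tail_reduced I F" disjoint_cones
    and "f \<in> F" "g \<in> F" "t \<in> keys f" "inv_divides m (lm lt g) t"
  shows "g = f"
proof -
  have "lm lt g \<in> lead I" using assms(2,5) F_nonzero by (auto simp: tail_reduced_def lead_def)
  moreover have "t \<in> mons n" using F_polys assms(4,6) by (auto simp: polys_iff)
  ultimately have "t \<in> lead I"
    using mono_ideal_dvd[OF mono_ideal_lead[OF assms(1)]] assms(7) by (auto simp: inv_divides_iff)
  then have "t = lm lt f" using assms(2,4,6) by (auto simp: tail_reduced_def)
  then have "inv_divides m (lm lt f) t" by simp
  then show ?thesis using assms(3-5,7) unfolding disjoint_cones_def by blast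
qed

lemma inv_NF_multiple_zero:
  assumes I: "is_ideal n I" "F \<subseteq> I"
    and complete: "\<And>p. p \<in> I \<Longrightarrow> p \<noteq> 0 \<Longrightarrow> \<exists>f\<in>F. inv_divides m (lm lt f) (lm lt p)"
    and "f \<in> F" "i \<in> {1..n}" "inv_NF m lt F (single (var i) 1 * f) r"
  shows "r = 0"
proof (rule inv_NF_zero[OF I complete _ assms(6)])
  have "single (var i) (1 :: 'a) \<in> polys n" using assms(5) by (intro polys_single var_in_mons)
  then show "single (var i) 1 * f \<in> I" using I assms(4) unfolding is_ideal_def by blast
qed

end

context monomial_order
begin

lemma inv_division_P_mult:
  assumes "F \<subseteq> polys n" "0 \<notin> F"
  shows "inv_division n lt (P_mult n) F"
proof unfold_locales
  show "P_mult n (lm lt f) \<subseteq> {1..n}" if "f \<in> F" for f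
    using that assms lm_in_mons by (intro P_mult_subset) blast
qed (use assms in auto)

lemma inv_division_J_mult:
  assumes "F \<subseteq> polys n" "0 \<notin> F"
  shows "inv_division n lt (J_mult n U) F"
  by unfold_locales (use assms in \<open>auto simp: J_mult_def\<close>)

section \<open>Characterisation of the bases by their leading monomials\<close>

lemma janet_basisD:
  fixes I :: "('a::field) mpoly set"
  assumes I: "is_ideal n I" and J: "janet_basis n lt I F"
  shows "finite F" "tail_reduced I F" "inv_complete (J_mult n (lm lt ` F)) (lead I) (lm lt ` F)"
proof -
  let ?U = "lm lt ` F" and ?m = "J_mult n (lm lt ` F)"
  show fin: "finite F" using J by (simp add: janet_basis_def)
  have Fp: "F \<subseteq> polys n" and F0: "0 \<notin> F" and ar: "J_autoreduced n lt F" and gen: "gen_ideal n F = I"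
    using J by (simp_all add: janet_basis_def)
  have FI: "F \<subseteq> I" using subset_gen_ideal gen by blast
  interpret inv_division n lt ?m F by (rule inv_division_J_mult[OF Fp F0])
  have ar': "g = f" if "f \<in> F" "g \<in> F" "t \<in> keys f" "inv_divides ?m (lm lt g) t" for f g t
    using ar that unfolding J_autoreduced_def J_divides_eq by blast
  have disj: disjoint_cones
    using J_cones_disjoint[of ?U] fin by (intro disjoint_cones_imageI autoreduced_inj_on_lm ar') auto
  have compl: "\<exists>f\<in>F. inv_divides ?m (lm lt f) (lm lt p)" if p: "p \<in> I" "p \<noteq> 0" for p
  proof (rule involutive_basis_complete[OF wf_lex_greater[of ?U] disj])
    show "finite ?U" using fin by simp
    fix f g i w
    assume fg: "f \<in> F" "g \<in> F" "i \<in> {1..n} - ?m (lm lt f)" "keys w \<subseteq> ?m (lm lt g)"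
      "lm lt f + var i = lm lt g + w"
    have "lex_greater (lm lt g) (lm lt f)"
    proof (rule J_continuous)
      show "inv_divides ?m (lm lt g) (lm lt f + var i)" using fg(4,5) by (auto simp: inv_divides_def)
    qed (use fg fin in auto)
    then show "(lm lt g, lm lt f) \<in> {(v, u). v \<in> ?U \<and> u \<in> ?U \<and> lex_greater v u}" using fg by auto
  next
    fix f i r assume "f \<in> F" "i \<in> {1..n} - ?m (lm lt f)" "inv_NF ?m lt F (single (var i) 1 * f) r"
    then show "r = 0" using J unfolding janet_basis_def NM_J_def NF_J_eq by blast
  qed (use p gen in auto)
  show "tail_reduced I F" by (rule autoreduced_tail_reduced[OF FI compl ar'])
  show "inv_complete ?m (lead I) ?U" using compl unfolding inv_complete_lead_iff by blast
qed

lemma janet_basisI: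
  fixes I :: "('a::field) mpoly set"
  assumes I: "is_ideal n I" and fin: "finite F" and red: "tail_reduced I F"
    and "inv_complete (J_mult n (lm lt ` F)) (lead I) (lm lt ` F)"
  shows "janet_basis n lt I F"
proof -
  let ?U = "lm lt ` F" and ?m = "J_mult n (lm lt ` F)"
  have FI: "F \<subseteq> I" and F0: "0 \<notin> F" and inj: "inj_on (lm lt) F"
    using red by (auto simp: tail_reduced_def)
  then have Fp: "F \<subseteq> polys n" using ideal_polys[OF I] by blast
  have compl: "\<exists>f\<in>F. inv_divides ?m (lm lt f) (lm lt p)" if "p \<in> I" "p \<noteq> 0" for p
    using assms(4) that unfolding inv_complete_lead_iff by blast
  interpret inv_division n lt ?m F by (rule inv_division_J_mult[OF Fp F0])
  have disj: disjoint_cones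
    using J_cones_disjoint[of ?U] fin by (intro disjoint_cones_imageI inj) auto
  have "J_autoreduced n lt F"
    unfolding J_autoreduced_def J_divides_eq using tail_reduced_autoreduced[OF I red disj] fin by blast
  moreover have "gen_ideal n F = I" by (rule gen_ideal_eq[OF I FI compl])
  moreover have "r = 0"
    if "f \<in> F" "i \<in> NM_J n ?U (lm lt f)" "NF_J n lt F (single (var i) 1 * f) r" for f i r
    using inv_NF_multiple_zero[OF I FI compl that(1)] that(2,3) unfolding NF_J_eq NM_J_def by blast
  ultimately show ?thesis
    using fin F_polys F0 unfolding janet_basis_def by blast
qed

text \<open>The assumption \<open>finite F\<close> makes \<open>lex_greater\<close> well-founded on
  the leading monomials, so continuity can yield completeness.\<close>

lemma pommaret_basisD:
  fixes I :: "('a::field) mpoly set"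
  assumes I: "is_ideal n I" and P: "pommaret_basis n lt I F" and fin: "finite F"
  shows "tail_reduced I F" "lm lt ` F = pom_gens (lead I)"
proof -
  let ?U = "lm lt ` F" and ?m = "P_mult n"
  have Fp: "F \<subseteq> polys n" and F0: "0 \<notin> F" and ar: "P_autoreduced n lt F" and gen: "gen_ideal n F = I"
    using P by (simp_all add: pommaret_basis_def)
  have FI: "F \<subseteq> I" using subset_gen_ideal gen by blast
  interpret inv_division n lt ?m F by (rule inv_division_P_mult[OF Fp F0])
  have ar': "g = f" if "f \<in> F" "g \<in> F" "t \<in> keys f" "inv_divides ?m (lm lt g) t" for f g t
    using ar that unfolding P_autoreduced_def P_divides_eq by blast
  have red: "P_reduced n ?U"
    unfolding P_reduced_def
  proof (intro conjI ballI impI)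
    show "?U \<subseteq> mons n" using F_elemD(3) by blast
    fix u v assume "u \<in> ?U" "v \<in> ?U" "inv_divides ?m u v"
    then show "u = v" using ar' lm_in_keys F_elemD(1,2) by blast
  qed
  have disj: disjoint_cones
    using P_cones_disjoint[OF red] by (intro disjoint_cones_imageI autoreduced_inj_on_lm ar') auto
  have compl: "\<exists>f\<in>F. inv_divides ?m (lm lt f) (lm lt p)" if p: "p \<in> I" "p \<noteq> 0" for p
  proof (rule involutive_basis_complete[OF wf_lex_greater[of ?U] disj])
    show "finite ?U" using fin by simp
    fix f g i w
    assume fg: "f \<in> F" "g \<in> F" "i \<in> {1..n} - ?m (lm lt f)" "keys w \<subseteq> ?m (lm lt g)"
      "lm lt f + var i = lm lt g + w"
    have "lex_greater (lm lt g) (lm lt f)"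
    proof (rule P_continuous[OF red])
      show "inv_divides ?m (lm lt g) (lm lt f + var i)" using fg(4,5) by (auto simp: inv_divides_def)
    qed (use fg in auto)
    then show "(lm lt g, lm lt f) \<in> {(v, u). v \<in> ?U \<and> u \<in> ?U \<and> lex_greater v u}" using fg by auto
  next
    fix f i r assume "f \<in> F" "i \<in> {1..n} - ?m (lm lt f)" "inv_NF ?m lt F (single (var i) 1 * f) r"
    then show "r = 0" using P unfolding pommaret_basis_def NM_P_def NF_P_eq by blast
  qed (use p gen in auto)
  show "tail_reduced I F" by (rule autoreduced_tail_reduced[OF FI compl ar'])
  have "inv_complete ?m (lead I) ?U" using compl unfolding inv_complete_lead_iff by blast
  then show "?U = pom_gens (lead I)"
    using P_basis_unique[OF mono_ideal_lead[OF I] lm_image_subset_lead[OF FI F0] red] by blast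
qed

lemma pommaret_basisI:
  fixes I :: "('a::field) mpoly set"
  assumes I: "is_ideal n I" and red: "tail_reduced I F" and lms: "lm lt ` F = pom_gens (lead I)"
  shows "pommaret_basis n lt I F"
proof -
  let ?U = "lm lt ` F" and ?m = "P_mult n"
  note M = mono_ideal_lead[OF I]
  have FI: "F \<subseteq> I" and F0: "0 \<notin> F" and inj: "inj_on (lm lt) F"
    using red by (auto simp: tail_reduced_def)
  then have Fp: "F \<subseteq> polys n" using ideal_polys[OF I] by blast
  have "inv_complete ?m (lead I) ?U" using pom_gens_complete[OF M] lms by simp
  then have compl: "\<exists>f\<in>F. inv_divides ?m (lm lt f) (lm lt p)" if "p \<in> I" "p \<noteq> 0" for p
    using that unfolding inv_complete_lead_iff by blast
  interpret inv_division n lt ?m F by (rule inv_division_P_mult[OF Fp F0])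
  have disj: disjoint_cones
    using P_cones_disjoint[OF P_reduced_pom_gens[OF M]] lms by (intro disjoint_cones_imageI inj) auto
  have "P_autoreduced n lt F"
    unfolding P_autoreduced_def P_divides_eq using tail_reduced_autoreduced[OF I red disj] by blast
  moreover have "gen_ideal n F = I" by (rule gen_ideal_eq[OF I FI compl])
  moreover have "r = 0"
    if "f \<in> F" "i \<in> NM_P n (lm lt f)" "NF_P n lt F (single (var i) 1 * f) r" for f i r
    using inv_NF_multiple_zero[OF I FI compl that(1)] that(2,3) unfolding NF_P_eq NM_P_def by blast
  ultimately show ?thesis
    using F_polys F0 unfolding pommaret_basis_def by blast
qed

end

section \<open>The algorithms\<close>

context monomial_order
begin

text \<open>Statement (iii) speaks about all Janet bases; this existence result keeps it from being
  vacuous when (i) is derived from it.\<close>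

lemma janet_basis_exists:
  fixes I :: "('a::field) mpoly set"
  assumes I: "is_ideal n I"
  obtains F where "janet_basis n lt I F"
proof -
  obtain U where U: "finite U" "U \<subseteq> lead I" "inv_complete (J_mult n U) (lead I) U"
    using finite_J_complete_exists[OF mono_ideal_lead[OF I]] by blast
  have "\<exists>f. f \<in> I \<and> f \<noteq> 0 \<and> lm lt f = u \<and> keys f \<inter> lead I = {u}" if "u \<in> U" for u
    using reduced_element_exists[OF I] U(2) that by (metis subsetD)
  then obtain f where f: "\<And>u. u \<in> U \<Longrightarrow> f u \<in> I \<and> f u \<noteq> 0 \<and> lm lt (f u) = u \<and> keys (f u) \<inter> lead I = {u}"
    by metis
  have "lm lt ` f ` U = U" using f by (force simp: image_image)
  moreover have "tail_reduced I (f ` U)"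
    using f by (auto simp: tail_reduced_def inj_on_def)
  ultimately have "janet_basis n lt I (f ` U)"
    using U by (intro janet_basisI[OF I]) auto
  then show ?thesis by (rule that)
qed

lemma tail_reduced_subset: "tail_reduced I F \<Longrightarrow> F' \<subseteq> F \<Longrightarrow> tail_reduced I F'"
  unfolding tail_reduced_def by (meson inj_on_subset subset_iff subset_trans)

lemma tail_reduced_pom_gens_janet:
  fixes I :: "('a::field) mpoly set"
  assumes I: "is_ideal n I" and "finite (pom_gens (lead I))"
    and "tail_reduced I F" "lm lt ` F = pom_gens (lead I)"
  shows "janet_basis n lt I F"
proof (rule janet_basisI[OF I])
  show "finite F" using assms by (metis finite_imageD tail_reduced_def)
  show "inv_complete (J_mult n (lm lt ` F)) (lead I) (lm lt ` F)"
    using pom_gens_J_complete[OF mono_ideal_lead[OF I]] assms(2,4) by simp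
qed fact

lemma pom_gens_subset_janet:
  fixes I :: "('a::field) mpoly set"
  assumes I: "is_ideal n I" and "finite (pom_gens (lead I))" and J: "janet_basis n lt I F"
  shows "pom_gens (lead I) \<subseteq> lm lt ` F"
proof (rule pom_gens_subset_J_complete[OF mono_ideal_lead[OF I] assms(2)])
  show "lm lt ` F \<subseteq> lead I"
    using janet_basisD(2)[OF I J] by (intro lm_image_subset_lead) (auto simp: tail_reduced_def)
qed (use janet_basisD[OF I J] in auto)

text \<open>The equivalence contains both that a normal form exists and that it is 0, so the loops
  below can be shown to have a run as well as a unique result.\<close>

lemma NF_J_pom_gens:
  fixes I :: "('a::field) mpoly set"
  assumes I: "is_ideal n I" and fin: "finite (pom_gens (lead I))"
    and C: "tail_reduced I C" "lm lt ` C = pom_gens (lead I)" and g: "g \<in> I"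
  shows "NF_J n lt C g r \<longleftrightarrow> r = 0"
proof -
  have CI: "C \<subseteq> I" and C0: "0 \<notin> C" using C(1) by (auto simp: tail_reduced_def)
  then have "C \<subseteq> polys n" and gp: "g \<in> polys n" using ideal_polys[OF I] g by auto
  then interpret inv_division n lt "J_mult n (lm lt ` C)" C by (intro inv_division_J_mult C0)
  have "inv_complete (J_mult n (lm lt ` C)) (lead I) (lm lt ` C)"
    using pom_gens_J_complete[OF mono_ideal_lead[OF I] fin] C(2) by simp
  then have compl: "\<exists>f\<in>C. inv_divides (J_mult n (lm lt ` C)) (lm lt f) (lm lt p)" if "p \<in> I" "p \<noteq> 0" for p
    using that unfolding inv_complete_lead_iff by blast
  have zero: "r = 0" if "NF_J n lt C g r" for r
    using inv_NF_zero[OF I CI compl g] that unfolding NF_J_eq by blast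
  moreover obtain r' where "NF_J n lt C g r'" using inv_NF_exists[OF gp] unfolding NF_J_eq by blast
  ultimately show ?thesis by blast
qed

end

lemma pj_move_terminates:
  assumes "finite H"
  obtains G' H' where "(pj_move n lt)\<^sup>*\<^sup>* (G, H) (G', H')"
    "\<not> (\<exists>h\<in>H'. lm lt h \<in> C_P n (lm lt ` (H' - {h})))"
  using assms
proof (induction "card H" arbitrary: G H thesis rule: less_induct)
  case less
  show ?case
  proof (cases "\<exists>h\<in>H. lm lt h \<in> C_P n (lm lt ` (H - {h}))")
    case True
    then obtain h where h: "h \<in> H" "lm lt h \<in> C_P n (lm lt ` (H - {h}))" by blast
    then have "pj_move n lt (G, H) (insert h G, H - {h})" by (auto simp: pj_move_def)
    moreover have "card (H - {h}) < card H" using card_Diff1_less[OF less.prems(2) h(1)] .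
    moreover have "finite (H - {h})" using less.prems(2) by simp
    ultimately obtain G' H' where step: "pj_move n lt (G, H) (insert h G, H - {h})"
      and GH: "(pj_move n lt)\<^sup>*\<^sup>* (insert h G, H - {h}) (G', H')"
        "\<not> (\<exists>h\<in>H'. lm lt h \<in> C_P n (lm lt ` (H' - {h})))"
      using less.hyps[of "H - {h}" "insert h G"] by blast
    show ?thesis
      by (rule less.prems(1)[OF converse_rtranclp_into_rtranclp[OF step GH(1)] GH(2)])
  qed (use less.prems(1) in blast)
qed

section \<open>The run of the algorithm on a Janet basis\<close>

locale finite_pommaret = monomial_order n lt for n lt +
  fixes I F :: "('a::field) mpoly set"
  assumes ideal: "is_ideal n I" and finite_gens: "finite (pom_gens (lead I))"
    and janet: "janet_basis n lt I F"
begin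

text \<open>This is the output in advance. Every intermediate set of the loop lies between
  \<open>core\<close> and \<open>F\<close>.\<close>

definition core :: "'a mpoly set" where
  "core = {f \<in> F. lm lt f \<in> pom_gens (lead I)}"

lemma core_subset: "core \<subseteq> F"
  by (auto simp: core_def)

lemma finite_F: "finite F"
  using janet_basisD(1)[OF ideal janet] .

lemma F_tail_reduced: "tail_reduced I F"
  using janet_basisD(2)[OF ideal janet] .

lemma F_subset_I: "F \<subseteq> I" and F_inj: "inj_on (lm lt) F"
  using F_tail_reduced by (auto simp: tail_reduced_def)

lemma lm_F: "f \<in> F \<Longrightarrow> lm lt f \<in> lead I"
  using F_tail_reduced lm_image_subset_lead by (auto simp: tail_reduced_def)

lemma core_tail_reduced: "tail_reduced I core"
  using tail_reduced_subset F_tail_reduced core_subset .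

lemma lm_core: "lm lt ` core = pom_gens (lead I)"
  using pom_gens_subset_janet[OF ideal finite_gens janet] by (auto simp: core_def)

lemma pommaret_core: "pommaret_basis n lt I core"
  by (rule pommaret_basisI[OF ideal core_tail_reduced lm_core])

lemma janet_core: "janet_basis n lt I core"
  by (rule tail_reduced_pom_gens_janet[OF ideal finite_gens core_tail_reduced lm_core])

text \<open>An element of \<open>core\<close> is never moved: its leading monomial has only itself
  as Pommaret divisor in \<open>lead I\<close>, and no other element of \<open>F\<close> shares
  it.\<close>

lemma pj_moves_core:
  assumes "(pj_move n lt)\<^sup>*\<^sup>* (G, X) (G', X')" "core \<subseteq> X" "X \<subseteq> F" "G \<subseteq> F"
  shows "core \<subseteq> X' \<and> X' \<subseteq> F \<and> G' \<subseteq> F"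
  using assms
proof (induction rule: rtranclp_induct2)
  case (step G1 X1 G2 X2)
  then have IH: "core \<subseteq> X1" "X1 \<subseteq> F" "G1 \<subseteq> F" by auto
  obtain h h' where h: "h \<in> X1" "h' \<in> X1 - {h}" "inv_divides (P_mult n) (lm lt h') (lm lt h)"
    "G2 = insert h G1" "X2 = X1 - {h}"
    using step(2) by (auto simp: pj_move_def C_P_def P_divides_eq)
  have "h \<notin> core"
  proof
    assume "h \<in> core"
    then have "lm lt h' = lm lt h"
      using pom_gens_P_divisor[OF mono_ideal_lead[OF ideal], of "lm lt h" "lm lt h'"] h IH lm_F
      by (auto simp: core_def)
    then show False using F_inj h(1,2) IH(2) by (auto dest: inj_onD)
  qed
  then show ?case using h IH by blast
qed auto

lemma pj_final_core:
  assumes "core \<subseteq> X" "X \<subseteq> F" "\<not> (\<exists>h\<in>X. lm lt h \<in> C_P n (lm lt ` (X - {h})))"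
  shows "X = core"
proof (rule ccontr)
  assume "X \<noteq> core"
  then obtain h where h: "h \<in> X" "h \<notin> core" using assms(1) by blast
  then obtain u where u: "u \<in> pom_gens (lead I)" "inv_divides (P_mult n) u (lm lt h)"
    using pom_gens_complete[OF mono_ideal_lead[OF ideal]] assms(2) lm_F unfolding inv_complete_def by blast
  then obtain f where "f \<in> core" "u = lm lt f" using lm_core by (metis imageE)
  then have "lm lt h \<in> C_P n (lm lt ` (X - {h}))"
    using u(2) h(2) assms(1) unfolding C_P_def P_divides_eq by blast
  then show False using assms(3) h(1) by blast
qed

text \<open>Each moved element reduces to 0 and leaves \<open>core\<close> unchanged, so the order
  of the list has no influence.\<close>

lemma pj_for_core: "set gs \<subseteq> F \<Longrightarrow> pj_for n lt core gs H \<longleftrightarrow> H = core"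
proof (induction gs)
  case Nil
  then show ?case by (auto intro: pj_for.intros elim: pj_for.cases)
next
  case (Cons g gs)
  have NF: "NF_J n lt core g f \<longleftrightarrow> f = 0" for f
    using NF_J_pom_gens[OF ideal finite_gens core_tail_reduced lm_core] Cons.prems F_subset_I by auto
  have "pj_for n lt core (g # gs) H \<longleftrightarrow> pj_for n lt core gs H"
  proof
    assume "pj_for n lt core (g # gs) H"
    then show "pj_for n lt core gs H" by cases (use NF in auto)
  next
    assume "pj_for n lt core gs H"
    then show "pj_for n lt core (g # gs) H" using pj_for_Cons[of n lt core g 0 gs H] NF by simp
  qed
  then show ?case using Cons by simp
qed

lemma pj_iter_core:
  assumes "core \<subseteq> X" "X \<subseteq> F"
  shows "pj_iter n lt X H \<longleftrightarrow> H = core"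
proof
  assume "pj_iter n lt X H"
  then obtain G H1 gs where *: "(pj_move n lt)\<^sup>*\<^sup>* ({}, X) (G, H1)"
      "\<not> (\<exists>h\<in>H1. lm lt h \<in> C_P n (lm lt ` (H1 - {h})))" "set gs = G" "pj_for n lt H1 gs H"
    unfolding pj_iter_def by blast
  have inv: "core \<subseteq> H1 \<and> H1 \<subseteq> F \<and> G \<subseteq> F" using pj_moves_core[OF *(1) assms] by simp
  then have "H1 = core" using pj_final_core *(2) by blast
  then show "H = core" using pj_for_core[of gs H] inv *(3,4) by simp
next
  assume H: "H = core"
  have "finite X" using assms(2) finite_F finite_subset by blast
  then obtain G H1 where *: "(pj_move n lt)\<^sup>*\<^sup>* ({}, X) (G, H1)"
      "\<not> (\<exists>h\<in>H1. lm lt h \<in> C_P n (lm lt ` (H1 - {h})))"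
    using pj_move_terminates[of X n lt "{}"] by blast
  have inv: "core \<subseteq> H1 \<and> H1 \<subseteq> F \<and> G \<subseteq> F" using pj_moves_core[OF *(1) assms] by simp
  then have "H1 = core" using pj_final_core *(2) by blast
  moreover obtain gs where "set gs = G" "distinct gs"
    using finite_distinct_list inv finite_F finite_subset by metis
  moreover have "pj_for n lt core gs core" using pj_for_core inv \<open>set gs = G\<close> by simp
  ultimately show "pj_iter n lt X H"
    unfolding pj_iter_def H using * by blast
qed

lemma pj_loop_core:
  assumes "pj_loop n lt X H" "core \<subseteq> X" "X \<subseteq> F"
  shows "H = core"
  using assms
proof (induction rule: pj_loop.induct)
  case (pj_continue X X' H)
  then show ?case using pj_iter_core core_subset by blast
qed (use pj_iter_core in blast)

text \<open>The rule \<open>pj_continue\<close> demands a changed set, so \<open>F = core\<close>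
  must stop in its first pass; otherwise the second pass is stationary.\<close>

lemma pj_loop_F: "pj_loop n lt F core"
proof (cases "F = core")
  case True
  then show ?thesis using pj_stop pj_iter_core core_subset by (metis order_refl)
next
  case False
  have "pj_loop n lt core core" using pj_stop pj_iter_core core_subset by blast
  then show ?thesis using pj_continue[of n lt F core core] False pj_iter_core core_subset by blast
qed

text \<open>A step may pick any \<open>h\<close> and reduces it modulo the others with their
  enlarged cones. A reducible term of \<open>h\<close> would lie in \<open>lead I\<close>, so it
  would be \<open>lm lt h\<close>, which \<open>pom_gens_J_irreducible\<close> excludes. Thus
  \<open>h\<close> is its own normal form and the step stutters.\<close>

lemma J_ar_step_core:
  assumes "J_ar_step n lt core H"
  shows "H = core"
proof -
  obtain h r where h: "h \<in> core" "NF_J n lt (core - {h}) h r"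
    "H = (if r = 0 then core - {h} else insert r (core - {h}))"
    using assms by (auto simp: J_ar_step_def)
  let ?u = "lm lt h"
  have lms: "lm lt ` (core - {h}) = pom_gens (lead I) - {?u}"
    using inj_on_image_set_diff[of "lm lt" core core "{h}"] h(1) lm_core core_tail_reduced
    by (simp add: tail_reduced_def)
  let ?m = "J_mult n (pom_gens (lead I) - {?u})"
  have irred: "\<not> inv_divides ?m (lm lt g) t" if g: "g \<in> core - {h}" and t: "t \<in> keys h" for g t
  proof
    assume d: "inv_divides ?m (lm lt g) t"
    have lg: "lm lt g \<in> pom_gens (lead I) - {?u}" using g lms by blast
    have "t \<in> mons n" using t h(1) core_subset F_subset_I ideal_polys[OF ideal] by (meson polys_iff subsetD)
    then have "t \<in> lead I"
      using mono_ideal_dvd[OF mono_ideal_lead[OF ideal], of "lm lt g" t] d lg pom_gens_subset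
      by (auto simp: inv_divides_iff)
    then have "t = ?u" using core_tail_reduced h(1) t by (auto simp: tail_reduced_def)
    moreover have "?u \<in> pom_gens (lead I)" using h(1) by (simp add: core_def)
    ultimately show False
      using pom_gens_J_irreducible[OF mono_ideal_lead[OF ideal] finite_gens _ lg] d by blast
  qed
  then have "\<not> inv_red ?m lt (core - {h}) h p" for p by (auto simp: inv_red_def)
  moreover have "(inv_red ?m lt (core - {h}))\<^sup>*\<^sup>* h r"
    using h(2) unfolding NF_J_eq lms inv_NF_def by blast
  ultimately have "r = h" by (auto elim: converse_rtranclpE)
  moreover have "h \<noteq> 0" using h(1) core_tail_reduced by (auto simp: tail_reduced_def)
  ultimately show ?thesis using h(1,3) by auto
qed

lemma autoreduce_J_core: "autoreduce_J n lt core G \<longleftrightarrow> G = core"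
proof -
  have "G = core" if "(J_ar_step n lt)\<^sup>*\<^sup>* core G" for G
    using that by induction (use J_ar_step_core in auto)
  moreover have "J_autoreduced n lt core" using janet_core by (simp add: janet_basis_def)
  ultimately show ?thesis by (auto simp: autoreduce_J_def)
qed

lemma autoreduce_PJ_iff: "autoreduce_PJ n lt F G \<longleftrightarrow> G = core"
  unfolding autoreduce_PJ_def
  using pj_loop_core[of F] pj_loop_F core_subset autoreduce_J_core by blast

end

theorem theorem3p4:
  fixes n :: nat and lt :: "mono \<Rightarrow> mono \<Rightarrow> bool" and I :: "('a::field_char_0) mpoly set"
  assumes "admissible_order n lt" and "vars_ordered n lt" and "is_ideal n I"
  shows "((\<exists>F. finite F \<and> pommaret_basis n lt I F) \<longleftrightarrow>
            ((\<exists>G. minimal_janet_basis n lt I G) \<and>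
             (\<forall>G. minimal_janet_basis n lt I G \<longrightarrow> pommaret_basis n lt I G))) \<and>
         ((\<exists>F. finite F \<and> pommaret_basis n lt I F) \<longleftrightarrow>
            (\<forall>F. janet_basis n lt I F \<longrightarrow>
                 (\<exists>G. autoreduce_PJ n lt F G) \<and>
                 (\<forall>G. autoreduce_PJ n lt F G \<longrightarrow> pommaret_basis n lt I G)))"
    (is "(?i \<longleftrightarrow> ?ii) \<and> (?i \<longleftrightarrow> ?iii)")
proof -
  interpret monomial_order n lt by unfold_locales fact
  note I = assms(3)
  let ?U = "pom_gens (lead I)"
  have i_ii: ?ii if ?i
  proof -
    from that obtain P where P: "finite P" "pommaret_basis n lt I P" by blast
    note PD = pommaret_basisD[OF I P(2,1)]
    have fin: "finite ?U" using P(1) PD(2) by (metis finite_imageI)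
    have JP: "janet_basis n lt I P" by (rule tail_reduced_pom_gens_janet[OF I fin PD])
    have min: "minimal_janet_basis n lt I P"
      unfolding minimal_janet_basis_def using JP pom_gens_subset_janet[OF I fin] PD(2) by auto
    have "pommaret_basis n lt I G" if G: "minimal_janet_basis n lt I G" for G
    proof (rule pommaret_basisI[OF I])
      have J: "janet_basis n lt I G" using G by (simp add: minimal_janet_basis_def)
      show "tail_reduced I G" by (rule janet_basisD(2)[OF I J])
      \<comment> \<open>Minimality of \<open>G\<close> is applied to the Janet basis
        \<open>P\<close>; the reverse inclusion holds for every Janet basis.\<close>
      have "lm lt ` G \<subseteq> lm lt ` P" using G JP unfolding minimal_janet_basis_def by blast
      then show "lm lt ` G = ?U" using pom_gens_subset_janet[OF I fin J] PD(2) by blast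
    qed
    with min show ?ii by blast
  qed
  have ii_i: ?i if ?ii
    \<comment> \<open>Janet bases are finite by definition, so the minimal one is a finite Pommaret
      basis.\<close>
    using that by (meson janet_basis_def minimal_janet_basis_def)
  have i_iii: ?iii if ?i
  proof (intro allI impI)
    from that obtain P where P: "finite P" "pommaret_basis n lt I P" by blast
    have fin: "finite ?U" using P(1) pommaret_basisD(2)[OF I P(2,1)] by (metis finite_imageI)
    fix F assume "janet_basis n lt I F"
    then interpret finite_pommaret n lt I F by unfold_locales (use I fin in auto)
    show "(\<exists>G. autoreduce_PJ n lt F G) \<and> (\<forall>G. autoreduce_PJ n lt F G \<longrightarrow> pommaret_basis n lt I G)"
      by (simp add: autoreduce_PJ_iff pommaret_core)
  qed
  have iii_i: ?i if iii: ?iii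
  proof -
    obtain F where "janet_basis n lt I F" using janet_basis_exists[OF I] .
    then obtain G where "autoreduce_PJ n lt F G" "pommaret_basis n lt I G" using iii by blast
    \<comment> \<open>Finiteness of \<open>G\<close> is part of being Janet autoreduced, the exit
      condition of the final autoreduction.\<close>
    then show ?i by (auto simp: autoreduce_PJ_def autoreduce_J_def J_autoreduced_def)
  qed
  show ?thesis using i_ii ii_i i_iii iii_i by argo
qed

end
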